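(* Let $k$ be an infinite field of characteristic different from $2$, let $H_4$ be the Sweedler Hopf algebra over $k$, let $a,b,c\in k$ with $a\ne0$, and let $\alpha:H_4\times H_4\to k$ be the normalized convolution-invertible two-cocycle with parameters $a,b,c$ given in the context. Then the algebra $\mathcal A_{H_4}^{\alpha}$ is isomorphic to the $\mathcal B_{H_4}^{\alpha}$-algebra generated by two variables $\xi,\eta$ subject to the relations $$\xi^2=X^2,\qquad\eta^2=Y^2,\qquad\xi\eta+\eta\xi=T,$$ where $X^2,Y^2,T$ denote the elements $X^2=at_x^2$, $Y^2=at_y^2+bt_1t_y+ct_1^2$, $T=t_x(2at_y+bt_1)$ of $\mathcal B_{H_4}^{\alpha}$.
   Context: All algebras are associative unital $k$-algebras; unadorned tensor products are over $k$; Sweedler notation is used. Sweedler algebra: $H=H_4$ is generated by $x,y$ with $x^2=1$, $y^2=0$, $xy+yx=0$; it has basis $\{1,x,y,z\}$ with $z=xy$, and $\Delta(x)=x\otimes x$, $\Delta(y)=1\otimes y+y\otimes x$, $\Delta(z)=x\otimes z+z\otimes1$, $\varepsilon(x)=1$, $\varepsilon(y)=\varepsilon(z)=0$, $S(x)=x$, $S(y)=z$, $S(z)=-y$. The cocycle: $\alpha(1,h)=\alpha(h,1)=\varepsilon(h)$; $\alpha(x,x)=a$, $\alpha(x,y)=\alpha(x,z)=0$; $\alpha(y,x)=b$, $\alpha(y,y)=c$, $\alpha(y,z)=-c$; $\alpha(z,x)=b$, $\alpha(z,y)=c$, $\alpha(z,z)=-ac$. The algebras $\mathcal B_H^{\alpha}$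 and $\mathcal A_H^{\alpha}$: let $t_H$ be a copy of the vector space $H$ (with identity map $h\mapsto t_h$), $S(t_H)=k[t_1,t_x,t_y,t_z]$ its symmetric algebra, $K_H$ the field of fractions. Let $t^{-1}:H\to K_H$, $h\mapsto t_h^{-1}$, be the unique linear map with $\sum t_{h_{(1)}}t^{-1}_{h_{(2)}}=\sum t^{-1}_{h_{(1)}}t_{h_{(2)}}=\varepsilon(h)1$; here $t_1^{-1}=1/t_1$, $t_x^{-1}=1/t_x$, $t_y^{-1}=-t_y/(t_1t_x)$, $t_z^{-1}=-t_z/(t_1t_x)$. Define $\sigma(g,h)=\sum t_{g_{(1)}}t_{h_{(1)}}\alpha(g_{(2)},h_{(2)})t^{-1}_{g_{(3)}h_{(3)}}$ and $\sigma^{-1}(g,h)=\sum t_{g_{(1)}h_{(1)}}\alpha^{-1}(g_{(2)},h_{(2)})t^{-1}_{g_{(3)}}t^{-1}_{h_{(3)}}$ ($\alpha^{-1}$ the convolution inverse of $\alpha$). $\mathcal B_H^{\alpha}$ is the subalgebra of $K_H$ generated by all values of $\sigma$ and $\sigma^{-1}$. $\mathcal A_H^{\alpha}=\mathcal B_H^{\alpha}\otimes{}^{\sigma}H$ is $\mathcal B_H^{\alpha}\otimes H$ with product $(p\otimes g)\cdot_\sigma(q\otimes h)=\sum pq\,\sigma(g_{(1)},h_{(1)})\otimes g_{(2)}h_{(2)}$; it is an associative $\mathcal B_H^{\alpha}$-algebra with unit $t_1^{-1}\otimes1$. Origin of the notation $X^2,Y^2,T$: these are the images, under the universal evaluation morphism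 $X_h\mapsto\sum t_{h_{(1)}}\otimes h_{(2)}$ from the tensor algebra on a copy $X_H$ of $H$ to $S(t_H)\otimes{}^{\alpha}H$ (where ${}^{\alpha}H$ is $H$ with product $g\cdot_\alpha h=\sum\alpha(g_{(1)},h_{(1)})g_{(2)}h_{(2)}$), of $X^2$, $Y^2$ and $T=XY+YX$, where $X=X_x$, $Y=X_y$; these images lie in $\mathcal B_H^{\alpha}\otimes1$. *)

theory Defs
  imports
    "HOL-Library.Poly_Mapping"
    "HOL-Computational_Algebra.Polynomial_Factorial"
    "HOL-Algebra.QuotRing"
    "HOL-Algebra.Module"
begin

section \<open>The Sweedler algebra\<close>

datatype h4 = H1 | HX | HY | HZ

text \<open>\<open>H1, HX, HY, HZ\<close> index the basis \<open>1, x, y, z = xy\<close>. The space \<open>H\<close> over \<open>'k\<close> is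
  \<^typ>\<open>h4 \<Rightarrow> 'k\<close> (coordinates), and a linear map on \<open>H\<close> or a bilinear map on \<open>H \<times> H\<close> is given
  by its values on the basis.\<close>

lemma UNIV_h4: "(UNIV :: h4 set) = {H1, HX, HY, HZ}"
  by (auto intro: h4.exhaust)

instance h4 :: finite
  by standard (simp add: UNIV_h4)

text \<open>The order on the basis has no mathematical role; it is what the library needs for
  polynomials in the variables \<open>t\<^sub>h\<close> to form an integral domain.\<close>

primrec h4_rank :: "h4 \<Rightarrow> nat" where
  "h4_rank H1 = 0" | "h4_rank HX = 1" | "h4_rank HY = 2" | "h4_rank HZ = 3"

instantiation h4 :: linorder
begin
definition less_eq_h4 :: "h4 \<Rightarrow> h4 \<Rightarrow> bool" where "g \<le> h \<longleftrightarrow> h4_rank g \<le> h4_rank h"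
definition less_h4 :: "h4 \<Rightarrow> h4 \<Rightarrow> bool" where "g < h \<longleftrightarrow> h4_rank g < h4_rank h"
instance
proof
  fix g h :: h4
  show "g = h" if "g \<le> h" "h \<le> g"
    using that by (cases g; cases h; simp add: less_eq_h4_def)
qed (auto simp: less_eq_h4_def less_h4_def)
end

lemma h4_all: "(\<forall>h. P h) \<longleftrightarrow> P H1 \<and> P HX \<and> P HY \<and> P HZ"
  using UNIV_h4 by (metis h4.exhaust)

definition bas :: "h4 \<Rightarrow> h4 \<Rightarrow> 'a::comm_ring_1" where
  "bas g = (\<lambda>m. if m = g then 1 else 0)"

definition tens :: "(h4 \<Rightarrow> 'a::comm_ring_1) \<Rightarrow> (h4 \<Rightarrow> 'a) \<Rightarrow> h4 \<Rightarrow> h4 \<Rightarrow> 'a" where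
  "tens f g = (\<lambda>i j. f i * g j)"

text \<open>The structure constants are \<open>0, 1, -1\<close>; they are used with values both in \<open>k\<close> and in
  the field of fractions \<open>K\<^sub>H\<close>.\<close>

fun hmul :: "h4 \<Rightarrow> h4 \<Rightarrow> h4 \<Rightarrow> 'a::comm_ring_1" where
  "hmul H1 h = bas h"
| "hmul HX H1 = bas HX"
| "hmul HX HX = bas H1"
| "hmul HX HY = bas HZ"
| "hmul HX HZ = bas HY"
| "hmul HY H1 = bas HY"
| "hmul HY HX = (\<lambda>m. - bas HZ m)"
| "hmul HY HY = (\<lambda>m. 0)"
| "hmul HY HZ = (\<lambda>m. 0)"
| "hmul HZ H1 = bas HZ"
| "hmul HZ HX = (\<lambda>m. - bas HY m)"
| "hmul HZ HY = (\<lambda>m. 0)"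
| "hmul HZ HZ = (\<lambda>m. 0)"

fun comul :: "h4 \<Rightarrow> h4 \<Rightarrow> h4 \<Rightarrow> 'a::comm_ring_1" where
  "comul H1 = tens (bas H1) (bas H1)"
| "comul HX = tens (bas HX) (bas HX)"
| "comul HY = (\<lambda>i j. tens (bas H1) (bas HY) i j + tens (bas HY) (bas HX) i j)"
| "comul HZ = (\<lambda>i j. tens (bas HX) (bas HZ) i j + tens (bas HZ) (bas H1) i j)"

text \<open>Coefficients of \<open>(\<Delta> \<otimes> id) \<circ> \<Delta>\<close>.\<close>

definition comul2 :: "h4 \<Rightarrow> h4 \<Rightarrow> h4 \<Rightarrow> h4 \<Rightarrow> 'a::comm_ring_1" where
  "comul2 h h1 h2 h3 = (\<Sum>l\<in>UNIV. comul h l h3 * comul l h1 h2)"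

fun counit :: "h4 \<Rightarrow> 'a::comm_ring_1" where
  "counit H1 = 1" | "counit HX = 1" | "counit HY = 0" | "counit HZ = 0"

lemma hmul_assoc:
  "(\<Sum>l\<in>UNIV. hmul f g l * hmul l h m) = (\<Sum>l\<in>UNIV. hmul g h l * (hmul f l m :: 'a::comm_ring_1))"
  by (cases f; cases g; cases h) (simp_all add: UNIV_h4 bas_def)

lemma comul_coassoc:
  "comul2 h h1 h2 h3 = (\<Sum>l\<in>UNIV. comul h h1 l * (comul l h2 h3 :: 'a::comm_ring_1))"
  by (cases h) (simp_all add: comul2_def UNIV_h4 bas_def tens_def)

lemma comul_hmul:
  "(\<Sum>l\<in>UNIV. hmul g h l * comul l m n) =
   (\<Sum>g1\<in>UNIV. \<Sum>g2\<in>UNIV. \<Sum>h1\<in>UNIV. \<Sum>h2\<in>UNIV.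
      comul g g1 g2 * comul h h1 h2 * hmul g1 h1 m * (hmul g2 h2 n :: 'a::comm_ring_1))"
  by (cases g; cases h; cases m; cases n) (simp_all add: UNIV_h4 bas_def tens_def)


section \<open>The cocycle and its convolution inverse\<close>

fun cocycle :: "'k::field \<Rightarrow> 'k \<Rightarrow> 'k \<Rightarrow> h4 \<Rightarrow> h4 \<Rightarrow> 'k" where
  "cocycle a b c H1 h = counit h"
| "cocycle a b c HX H1 = counit HX"
| "cocycle a b c HX HX = a"
| "cocycle a b c HX HY = 0"
| "cocycle a b c HX HZ = 0"
| "cocycle a b c HY H1 = counit HY"
| "cocycle a b c HY HX = b"
| "cocycle a b c HY HY = c"
| "cocycle a b c HY HZ = - c"
| "cocycle a b c HZ H1 = counit HZ"
| "cocycle a b c HZ HX = b"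
| "cocycle a b c HZ HY = c"
| "cocycle a b c HZ HZ = - (a * c)"

definition conv :: "(h4 \<Rightarrow> h4 \<Rightarrow> 'a::comm_ring_1) \<Rightarrow> (h4 \<Rightarrow> h4 \<Rightarrow> 'a) \<Rightarrow> h4 \<Rightarrow> h4 \<Rightarrow> 'a" where
  "conv \<alpha> \<beta> g h =
    (\<Sum>g1\<in>UNIV. \<Sum>g2\<in>UNIV. \<Sum>h1\<in>UNIV. \<Sum>h2\<in>UNIV.
      comul g g1 g2 * comul h h1 h2 * \<alpha> g1 h1 * \<beta> g2 h2)"

lemma comul_sum:
  "(\<Sum>i\<in>UNIV. \<Sum>j\<in>UNIV. comul h i j * F i j) = (case h of
      H1 \<Rightarrow> F H1 H1 | HX \<Rightarrow> F HX HX | HY \<Rightarrow> F H1 HY + F HY HX | HZ \<Rightarrow> F HX HZ + F HZ H1)"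
  by (cases h) (simp_all add: UNIV_h4 bas_def tens_def)

lemma conv_eq:
  "conv \<alpha> \<beta> g h =
    (\<Sum>g1\<in>UNIV. \<Sum>g2\<in>UNIV. comul g g1 g2 *
      (\<Sum>h1\<in>UNIV. \<Sum>h2\<in>UNIV. comul h h1 h2 * (\<alpha> g1 h1 * \<beta> g2 h2)))"
  by (simp add: conv_def sum_distrib_left mult.assoc)

definition is_conv_inv :: "(h4 \<Rightarrow> h4 \<Rightarrow> 'a::comm_ring_1) \<Rightarrow> (h4 \<Rightarrow> h4 \<Rightarrow> 'a) \<Rightarrow> bool" where
  "is_conv_inv \<alpha> \<beta> \<longleftrightarrow>
    (\<forall>g h. conv \<alpha> \<beta> g h = counit g * counit h \<and> conv \<beta> \<alpha> g h = counit g * counit h)"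

definition conv_inv :: "(h4 \<Rightarrow> h4 \<Rightarrow> 'a::comm_ring_1) \<Rightarrow> h4 \<Rightarrow> h4 \<Rightarrow> 'a" where
  "conv_inv \<alpha> = (THE \<beta>. is_conv_inv \<alpha> \<beta>)"

fun cocycle_inv :: "'k::field \<Rightarrow> 'k \<Rightarrow> 'k \<Rightarrow> h4 \<Rightarrow> h4 \<Rightarrow> 'k" where
  "cocycle_inv a b c H1 h = counit h"
| "cocycle_inv a b c HX H1 = 1"
| "cocycle_inv a b c HX HX = 1 / a"
| "cocycle_inv a b c HX HY = 0"
| "cocycle_inv a b c HX HZ = 0"
| "cocycle_inv a b c HY H1 = 0"
| "cocycle_inv a b c HY HX = - b / a"
| "cocycle_inv a b c HY HY = - c / a"
| "cocycle_inv a b c HY HZ = c"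
| "cocycle_inv a b c HZ H1 = 0"
| "cocycle_inv a b c HZ HX = - b / a"
| "cocycle_inv a b c HZ HY = - c"
| "cocycle_inv a b c HZ HZ = c"

lemma is_conv_inv_cocycle_inv:
  assumes "a \<noteq> 0"
  shows "is_conv_inv (cocycle a b c) (cocycle_inv a b c)"
  unfolding is_conv_inv_def h4_all
  using assms by (simp add: conv_eq comul_sum del: comul.simps)

lemma is_conv_inv_cocycle_unique:
  assumes a: "a \<noteq> 0" and \<beta>: "is_conv_inv (cocycle a b c) \<beta>"
  shows "\<beta> = cocycle_inv a b c"
proof -
  have e: "\<beta> H1 H1 = 1" "\<beta> H1 HX = 1" "\<beta> H1 HY = 0" "\<beta> H1 HZ = 0"
    "\<beta> HX H1 = 1" "a * \<beta> HX HX = 1" "\<beta> HX HY = 0" "\<beta> HX HZ = 0"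
    "\<beta> HY H1 = 0" "b + \<beta> HY HX * a = 0"
    "\<beta> HY HY + c * \<beta> HX HX = 0" "\<beta> HY HZ = c"
    "\<beta> HZ H1 = 0" "\<beta> HX HX * b + \<beta> HZ HX = 0"
    "\<beta> HZ HY + c = 0" "\<beta> HZ HZ = \<beta> HX HX * (a * c)"
    using \<beta> unfolding is_conv_inv_def h4_all
    by (auto simp: conv_eq comul_sum simp del: comul.simps)
  have xx: "\<beta> HX HX = 1 / a"
    using e(6) a by (simp add: field_simps)
  show ?thesis
    using e xx a by (simp add: fun_eq_iff h4_all field_simps eq_neg_iff_add_eq_0)
qed

lemma conv_inv_cocycle:
  "a \<noteq> 0 \<Longrightarrow> conv_inv (cocycle a b c) = cocycle_inv a b c"
  unfolding conv_inv_def
  by (rule the_equality) (simp_all add: is_conv_inv_cocycle_inv is_conv_inv_cocycle_unique)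


section \<open>The field \<open>K\<^sub>H\<close> and the generic cocycle\<close>

text \<open>The symmetric algebra \<open>S(t\<^sub>H)\<close> is the polynomial ring over \<open>k\<close> in variables indexed by the
  basis of \<open>H\<close>.\<close>

type_synonym 'k St = "(h4 \<Rightarrow>\<^sub>0 nat) \<Rightarrow>\<^sub>0 'k"
type_synonym 'k KH = "'k St fract"

definition kconst :: "'k::field \<Rightarrow> 'k KH" where
  "kconst r = to_fract (Poly_Mapping.single 0 r)"

definition tv :: "h4 \<Rightarrow> 'k::field KH" where
  "tv h = to_fract (Poly_Mapping.single (Poly_Mapping.single h 1) 1)"

definition is_tv_inv :: "(h4 \<Rightarrow> 'k::field KH) \<Rightarrow> bool" where
  "is_tv_inv u \<longleftrightarrow> (\<forall>h.
    (\<Sum>h1\<in>UNIV. \<Sum>h2\<in>UNIV. comul h h1 h2 * tv h1 * u h2) = counit h \<and>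
    (\<Sum>h1\<in>UNIV. \<Sum>h2\<in>UNIV. comul h h1 h2 * u h1 * tv h2) = counit h)"

definition tv_inv :: "h4 \<Rightarrow> 'k::field KH" where
  "tv_inv = (THE u. is_tv_inv u)"

lemma tv_nonzero: "tv h \<noteq> (0 :: 'k::field KH)"
  unfolding tv_def to_fract_eq_0_iff by (metis lookup_single_eq lookup_zero one_neq_zero)

lemma is_tv_inv_iff:
  "is_tv_inv (u :: h4 \<Rightarrow> 'k::field KH) \<longleftrightarrow>
    u H1 = 1 / tv H1 \<and> u HX = 1 / tv HX \<and>
    u HY = - tv HY / (tv H1 * tv HX) \<and> u HZ = - tv HZ / (tv H1 * tv HX)" (is "_ \<longleftrightarrow> ?R")
proof
  assume "is_tv_inv u"
  then have u: "tv H1 * u H1 = 1" "tv HX * u HX = 1"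
      "tv H1 * u HY + tv HY * u HX = 0" "tv HX * u HZ + tv HZ * u H1 = 0"
    by (simp_all add: is_tv_inv_def h4_all UNIV_h4 bas_def tens_def)
  have h: "u H1 = 1 / tv H1" "u HX = 1 / tv HX"
    using u(1,2) tv_nonzero by (metis nonzero_mult_div_cancel_left)+
  have "u HY = - (tv HY * u HX) / tv H1" "u HZ = - (tv HZ * u H1) / tv HX"
    using u(3,4) tv_nonzero
    by (metis eq_neg_iff_add_eq_0 nonzero_mult_div_cancel_left)+
  with h show ?R
    by (simp add: mult.commute)
next
  assume ?R
  then show "is_tv_inv u"
    by (simp add: is_tv_inv_def h4_all UNIV_h4 bas_def tens_def tv_nonzero)
qed

lemma tv_inv_values:
  "tv_inv H1 = (1 / tv H1 :: 'k::field KH)"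
  "tv_inv HX = (1 / tv HX :: 'k KH)"
  "tv_inv HY = (- tv HY / (tv H1 * tv HX) :: 'k KH)"
  "tv_inv HZ = (- tv HZ / (tv H1 * tv HX) :: 'k KH)"
proof -
  have "\<exists>!u :: h4 \<Rightarrow> 'k KH. is_tv_inv u"
  proof (rule ex_ex1I, rule exI)
    show "is_tv_inv (\<lambda>h :: h4. case h of H1 \<Rightarrow> (1 / tv H1 :: 'k KH) | HX \<Rightarrow> 1 / tv HX
        | HY \<Rightarrow> - tv HY / (tv H1 * tv HX) | HZ \<Rightarrow> - tv HZ / (tv H1 * tv HX))"
      by (simp add: is_tv_inv_iff)
  next
    fix u v :: "h4 \<Rightarrow> 'k KH"
    assume "is_tv_inv u" "is_tv_inv v"
    then show "u = v"
      by (simp add: is_tv_inv_iff fun_eq_iff h4_all)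
  qed
  from theI'[OF this] show
    "tv_inv H1 = (1 / tv H1 :: 'k KH)" "tv_inv HX = (1 / tv HX :: 'k KH)"
    "tv_inv HY = (- tv HY / (tv H1 * tv HX) :: 'k KH)"
    "tv_inv HZ = (- tv HZ / (tv H1 * tv HX) :: 'k KH)"
    unfolding tv_inv_def is_tv_inv_iff by auto
qed

definition sigma_bas :: "(h4 \<Rightarrow> h4 \<Rightarrow> 'k::field) \<Rightarrow> h4 \<Rightarrow> h4 \<Rightarrow> 'k KH" where
  "sigma_bas \<alpha> g h =
    (\<Sum>g1\<in>UNIV. \<Sum>g2\<in>UNIV. \<Sum>g3\<in>UNIV. \<Sum>h1\<in>UNIV. \<Sum>h2\<in>UNIV. \<Sum>h3\<in>UNIV.
      comul2 g g1 g2 g3 * comul2 h h1 h2 h3 *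
      (tv g1 * tv h1 * kconst (\<alpha> g2 h2) * (\<Sum>m\<in>UNIV. hmul g3 h3 m * tv_inv m)))"

definition sigma_inv_bas :: "(h4 \<Rightarrow> h4 \<Rightarrow> 'k::field) \<Rightarrow> h4 \<Rightarrow> h4 \<Rightarrow> 'k KH" where
  "sigma_inv_bas \<alpha> g h =
    (\<Sum>g1\<in>UNIV. \<Sum>g2\<in>UNIV. \<Sum>g3\<in>UNIV. \<Sum>h1\<in>UNIV. \<Sum>h2\<in>UNIV. \<Sum>h3\<in>UNIV.
      comul2 g g1 g2 g3 * comul2 h h1 h2 h3 *
      ((\<Sum>m\<in>UNIV. hmul g1 h1 m * tv m) * kconst (conv_inv \<alpha> g2 h2) * tv_inv g3 * tv_inv h3))"

definition bilin_ext :: "(h4 \<Rightarrow> h4 \<Rightarrow> 'k KH) \<Rightarrow> (h4 \<Rightarrow> 'k::field) \<Rightarrow> (h4 \<Rightarrow> 'k) \<Rightarrow> 'k KH" where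
  "bilin_ext s u v = (\<Sum>g\<in>UNIV. \<Sum>h\<in>UNIV. kconst (u g) * kconst (v h) * s g h)"

inductive_set subalg :: "'k::field KH set \<Rightarrow> 'k KH set" for S where
  scalar: "kconst r \<in> subalg S"
| gen: "s \<in> S \<Longrightarrow> s \<in> subalg S"
| add: "p \<in> subalg S \<Longrightarrow> q \<in> subalg S \<Longrightarrow> p + q \<in> subalg S"
| mult: "p \<in> subalg S \<Longrightarrow> q \<in> subalg S \<Longrightarrow> p * q \<in> subalg S"

definition B_set :: "(h4 \<Rightarrow> h4 \<Rightarrow> 'k::field) \<Rightarrow> 'k KH set" where
  "B_set \<alpha> = subalg
    ({bilin_ext (sigma_bas \<alpha>) u v |u v. True} \<union> {bilin_ext (sigma_inv_bas \<alpha>) u v |u v. True})"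

definition ring_on :: "'c::comm_ring_1 set \<Rightarrow> 'c ring" where
  "ring_on B = \<lparr>carrier = B, mult = (*), one = 1, zero = 0, add = (+)\<rparr>"


section \<open>Algebras over a commutative ring\<close>

text \<open>\<^locale>\<open>algebra\<close> from the library only covers commutative algebras.\<close>

locale assoc_algebra = module + ring M +
  assumes smult_mult_left: "\<lbrakk>r \<in> carrier R; x \<in> carrier M; y \<in> carrier M\<rbrakk> \<Longrightarrow>
      (r \<odot>\<^bsub>M\<^esub> x) \<otimes>\<^bsub>M\<^esub> y = r \<odot>\<^bsub>M\<^esub> (x \<otimes>\<^bsub>M\<^esub> y)"
    and smult_mult_right: "\<lbrakk>r \<in> carrier R; x \<in> carrier M; y \<in> carrier M\<rbrakk> \<Longrightarrow>
      x \<otimes>\<^bsub>M\<^esub> (r \<odot>\<^bsub>M\<^esub> y) = r \<odot>\<^bsub>M\<^esub> (x \<otimes>\<^bsub>M\<^esub> y)"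

definition algebra_isomorphic ::
  "('r, 'm) ring_scheme \<Rightarrow> ('r, 'a) module \<Rightarrow> ('r, 'b) module \<Rightarrow> bool" where
  "algebra_isomorphic R M N \<longleftrightarrow> assoc_algebra R M \<and> assoc_algebra R N \<and>
    (\<exists>\<phi> \<in> ring_iso M N. \<forall>r\<in>carrier R. \<forall>x\<in>carrier M. \<phi> (r \<odot>\<^bsub>M\<^esub> x) = r \<odot>\<^bsub>N\<^esub> \<phi> x)"

definition quot_algebra :: "('r, 'a) module \<Rightarrow> 'a set \<Rightarrow> ('r, 'a set) module" where
  "quot_algebra M I =
    ring.extend (M Quot I) \<lparr>smult = (\<lambda>r C. \<Union>c\<in>C. I +>\<^bsub>M\<^esub> (r \<odot>\<^bsub>M\<^esub> c))\<rparr>"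

text \<open>The free algebra over a subring \<open>B\<close> on a set of letters: finitely supported functions on
  words, multiplied by convolution along concatenation.\<close>

definition free_algebra :: "'c::comm_ring_1 set \<Rightarrow> ('c, 'v list \<Rightarrow> 'c) module" where
  "free_algebra B =
    \<lparr>carrier = {f. finite {w. f w \<noteq> 0} \<and> range f \<subseteq> B},
     mult = (\<lambda>f g w. \<Sum>i\<le>length w. f (take i w) * g (drop i w)),
     one = (\<lambda>w. if w = [] then 1 else 0),
     zero = (\<lambda>w. 0),
     add = (\<lambda>f g w. f w + g w),
     smult = (\<lambda>r f w. r * f w)\<rparr>"

definition letter :: "'v \<Rightarrow> 'v list \<Rightarrow> 'c::comm_ring_1" where
  "letter v = (\<lambda>w. if w = [v] then 1 else 0)"

datatype gen = Xi | Eta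

definition two_gen_algebra :: "'c::comm_ring_1 set \<Rightarrow> 'c \<Rightarrow> 'c \<Rightarrow> 'c \<Rightarrow> ('c, (gen list \<Rightarrow> 'c) set) module" where
  "two_gen_algebra B p q r =
    (let F = free_algebra B; \<xi> = letter Xi; \<eta> = letter Eta in
     quot_algebra F (Idl\<^bsub>F\<^esub>
       {(\<xi> \<otimes>\<^bsub>F\<^esub> \<xi>) \<ominus>\<^bsub>F\<^esub> (p \<odot>\<^bsub>F\<^esub> \<one>\<^bsub>F\<^esub>),
        (\<eta> \<otimes>\<^bsub>F\<^esub> \<eta>) \<ominus>\<^bsub>F\<^esub> (q \<odot>\<^bsub>F\<^esub> \<one>\<^bsub>F\<^esub>),
        ((\<xi> \<otimes>\<^bsub>F\<^esub> \<eta>) \<oplus>\<^bsub>F\<^esub> (\<eta> \<otimes>\<^bsub>F\<^esub> \<xi>)) \<ominus>\<^bsub>F\<^esub> (r \<odot>\<^bsub>F\<^esub> \<one>\<^bsub>F\<^esub>)}))"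


section \<open>The algebra \<open>\<A>\<close>\<close>

text \<open>An element \<open>u\<close> of \<open>B \<otimes> H\<close> is given by its coordinates: \<open>\<Sum>h. u h \<otimes> h\<close> with \<open>u h \<in> B\<close>.\<close>

definition A_alg :: "(h4 \<Rightarrow> h4 \<Rightarrow> 'k::field) \<Rightarrow> ('k KH, h4 \<Rightarrow> 'k KH) module" where
  "A_alg \<alpha> =
    \<lparr>carrier = {u. range u \<subseteq> B_set \<alpha>},
     mult = (\<lambda>u v m. \<Sum>g\<in>UNIV. \<Sum>h\<in>UNIV. u g * v h *
       (\<Sum>g1\<in>UNIV. \<Sum>g2\<in>UNIV. \<Sum>h1\<in>UNIV. \<Sum>h2\<in>UNIV.
          comul g g1 g2 * comul h h1 h2 * sigma_bas \<alpha> g1 h1 * hmul g2 h2 m)),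
     one = (\<lambda>m. inverse (tv H1) * bas H1 m),
     zero = (\<lambda>m. 0),
     add = (\<lambda>u v m. u m + v m),
     smult = (\<lambda>r u m. r * u m)\<rparr>"

definition X2 :: "'k::field \<Rightarrow> 'k KH" where
  "X2 a = kconst a * tv HX ^ 2"

definition Y2 :: "'k::field \<Rightarrow> 'k \<Rightarrow> 'k \<Rightarrow> 'k KH" where
  "Y2 a b c = kconst a * tv HY ^ 2 + kconst b * tv H1 * tv HY + kconst c * tv H1 ^ 2"

definition TT :: "'k::field \<Rightarrow> 'k \<Rightarrow> 'k KH" where
  "TT a b = tv HX * (2 * kconst a * tv HY + kconst b * tv H1)"

end

theory Submission
  imports Defs
begin

text \<open>Write \<open>x, y\<close> for \<open>1 \<otimes> x, 1 \<otimes> y \<in> \<A>\<close>. The product of \<open>\<A>\<close> gives \<open>x\<^sup>2 = X\<^sup>2\<close>, \<open>y\<^sup>2 = Y\<^sup>2\<close> and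
  \<open>xy + yx = T\<close>, with \<open>X\<^sup>2 = t\<^sub>1\<sigma>(x,x)\<close>, \<open>Y\<^sup>2 = t\<^sub>1\<sigma>(y,y)\<close> and \<open>T = t\<^sub>1(\<sigma>(x,y) + \<sigma>(y,x))\<close>. So
  \<open>\<xi> \<mapsto> x, \<eta> \<mapsto> y\<close> defines a morphism from the algebra with two generators to \<open>\<A>\<close>. The source is
  spanned by \<open>1, \<xi>, \<eta>, \<xi>\<eta>\<close>, because their span is stable under left multiplication by \<open>\<xi>\<close> and
  \<open>\<eta>\<close>. Since \<open>xy = t\<^sub>1 \<otimes> z + \<sigma>(x,y) \<otimes> 1\<close>, the unit is \<open>t\<^sub>1\<^sup>-\<^sup>1 \<otimes> 1\<close> and \<open>t\<^sub>1\<close> is invertible in \<open>\<B>\<close>,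
  the images \<open>1, x, y, xy\<close> form a basis of \<open>\<A>\<close>, hence the morphism is bijective.\<close>

section \<open>Quotients of algebras\<close>

locale algebra_ideal = assoc_algebra R M + I?: ideal I M
  for R :: "('r, 'm) ring_scheme" and M :: "('r, 'a) module" and I :: "'a set"
begin

lemma smult_in_ideal:
  assumes "r \<in> carrier R" "i \<in> I"
  shows "r \<odot>\<^bsub>M\<^esub> i \<in> I"
proof -
  have i: "i \<in> carrier M" using assms(2) I.a_subset by auto
  have "(r \<odot>\<^bsub>M\<^esub> \<one>\<^bsub>M\<^esub>) \<otimes>\<^bsub>M\<^esub> i = r \<odot>\<^bsub>M\<^esub> i"
    using assms(1) i by (simp add: smult_mult_left)
  then show ?thesis
    using I.I_l_closed[OF assms(2), of "r \<odot>\<^bsub>M\<^esub> \<one>\<^bsub>M\<^esub>"] assms(1) by simp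
qed

lemma quot_algebra_simps:
  "carrier (quot_algebra M I) = carrier (M Quot I)"
  "mult (quot_algebra M I) = mult (M Quot I)"
  "one (quot_algebra M I) = I +>\<^bsub>M\<^esub> \<one>\<^bsub>M\<^esub>"
  "zero (quot_algebra M I) = I"
  "add (quot_algebra M I) = add (M Quot I)"
  by (simp_all add: quot_algebra_def FactRing_def ring.extend_def)

lemma quot_algebra_carrier:
  "carrier (quot_algebra M I) = (\<lambda>x. I +>\<^bsub>M\<^esub> x) ` carrier M"
  by (auto simp: quot_algebra_simps FactRing_simps)

lemma
  assumes x: "x \<in> carrier M"
  shows quot_algebra_add: "y \<in> carrier M \<Longrightarrow>
      (I +>\<^bsub>M\<^esub> x) \<oplus>\<^bsub>quot_algebra M I\<^esub> (I +>\<^bsub>M\<^esub> y) = I +>\<^bsub>M\<^esub> (x \<oplus>\<^bsub>M\<^esub> y)"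
    and quot_algebra_mult: "y \<in> carrier M \<Longrightarrow>
      (I +>\<^bsub>M\<^esub> x) \<otimes>\<^bsub>quot_algebra M I\<^esub> (I +>\<^bsub>M\<^esub> y) = I +>\<^bsub>M\<^esub> (x \<otimes>\<^bsub>M\<^esub> y)"
    and quot_algebra_smult: "r \<in> carrier R \<Longrightarrow>
      r \<odot>\<^bsub>quot_algebra M I\<^esub> (I +>\<^bsub>M\<^esub> x) = I +>\<^bsub>M\<^esub> (r \<odot>\<^bsub>M\<^esub> x)"
proof -
  show "(I +>\<^bsub>M\<^esub> x) \<oplus>\<^bsub>quot_algebra M I\<^esub> (I +>\<^bsub>M\<^esub> y) = I +>\<^bsub>M\<^esub> (x \<oplus>\<^bsub>M\<^esub> y)"
    "(I +>\<^bsub>M\<^esub> x) \<otimes>\<^bsub>quot_algebra M I\<^esub> (I +>\<^bsub>M\<^esub> y) = I +>\<^bsub>M\<^esub> (x \<otimes>\<^bsub>M\<^esub> y)"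
    if "y \<in> carrier M" for y
    using x that by (simp_all add: quot_algebra_simps FactRing_simps I.rcoset_mult_add I.a_rcos_sum)
  show "r \<odot>\<^bsub>quot_algebra M I\<^esub> (I +>\<^bsub>M\<^esub> x) = I +>\<^bsub>M\<^esub> (r \<odot>\<^bsub>M\<^esub> x)" if r: "r \<in> carrier R"
  proof -
    have *: "I +>\<^bsub>M\<^esub> (r \<odot>\<^bsub>M\<^esub> c) = I +>\<^bsub>M\<^esub> (r \<odot>\<^bsub>M\<^esub> x)" if "c \<in> I +>\<^bsub>M\<^esub> x" for c
    proof -
      obtain i where i: "i \<in> I" "c = i \<oplus>\<^bsub>M\<^esub> x"
        using \<open>c \<in> I +>\<^bsub>M\<^esub> x\<close> by (auto simp: a_r_coset_def r_coset_def)
      have "r \<odot>\<^bsub>M\<^esub> c = r \<odot>\<^bsub>M\<^esub> i \<oplus>\<^bsub>M\<^esub> r \<odot>\<^bsub>M\<^esub> x"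
        using i r x I.a_subset by (auto simp: smult_r_distr)
      then have "r \<odot>\<^bsub>M\<^esub> c \<in> I +>\<^bsub>M\<^esub> (r \<odot>\<^bsub>M\<^esub> x)"
        using smult_in_ideal[OF r i(1)] by (auto simp: a_r_coset_def r_coset_def)
      then show ?thesis
        using I.a_repr_independence' r x by (metis smult_closed)
    qed
    have "I +>\<^bsub>M\<^esub> x \<noteq> {}"
      using I.a_rcos_self[OF x] by blast
    then have "(\<Union>c\<in>I +>\<^bsub>M\<^esub> x. I +>\<^bsub>M\<^esub> (r \<odot>\<^bsub>M\<^esub> c)) = I +>\<^bsub>M\<^esub> (r \<odot>\<^bsub>M\<^esub> x)"
      by (rule SUP_eq_const[OF _ *])
    then show ?thesis
      by (simp add: quot_algebra_def ring.extend_def)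
  qed
qed

lemma assoc_algebra_quot_algebra: "assoc_algebra R (quot_algebra M I)"
proof -
  let ?Q = "quot_algebra M I"
  note Q = I.quotient_is_ring
  have eqs: "zero ?Q = zero (M Quot I)" "one ?Q = one (M Quot I)"
    by (simp_all add: quot_algebra_simps FactRing_def)
  have g: "abelian_group ?Q"
    by (intro abelian_groupI; unfold quot_algebra_simps(1,5) eqs;
        metis abelian_groupE[OF ringE(1)[OF Q]])
  have mon: "Group.monoid ?Q"
    using ringE(2)[OF Q] unfolding Group.monoid_def quot_algebra_simps(1,2,5) eqs .
  have r: "ring ?Q"
    by (intro ringI g mon; unfold quot_algebra_simps(1,2,5); rule ringE(3,4)[OF Q])
  have m: "module R ?Q"
    by (rule moduleI[OF R.is_cring g])
      (auto simp: quot_algebra_carrier quot_algebra_add quot_algebra_smult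
        smult_l_distr smult_r_distr smult_assoc1)
  show ?thesis
    by (intro assoc_algebra.intro m r assoc_algebra_axioms.intro)
      (auto simp: quot_algebra_carrier quot_algebra_mult quot_algebra_smult
        smult_mult_left smult_mult_right)
qed

end

lemma algebra_isomorphic_quot_kernel:
  assumes M: "assoc_algebra R M" and N: "assoc_algebra R N"
    and h: "h \<in> ring_hom M N" "h ` carrier M = carrier N"
    and lin: "\<And>r x. r \<in> carrier R \<Longrightarrow> x \<in> carrier M \<Longrightarrow> h (r \<odot>\<^bsub>M\<^esub> x) = r \<odot>\<^bsub>N\<^esub> h x"
  shows "algebra_isomorphic R N (quot_algebra M (a_kernel M N h))"
proof -
  interpret M: assoc_algebra R M by fact
  interpret N: assoc_algebra R N by fact
  interpret h: ring_hom_ring M N h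
    by (rule ring_hom_ringI2[OF M.ring_axioms N.ring_axioms h(1)])
  let ?I = "a_kernel M N h"
  let ?Q = "quot_algebra M ?I"
  have I: "ideal ?I M" by (rule h.kernel_is_ideal)
  interpret I: algebra_ideal R M ?I
    by (rule algebra_ideal.intro[OF M I])
  have surj: "\<exists>x. x \<in> carrier M \<and> h x = u" if "u \<in> carrier N" for u
    using that h(2) by (metis imageE)
  define s where "s u = (SOME x. x \<in> carrier M \<and> h x = u)" for u
  have s: "s u \<in> carrier M \<and> h (s u) = u" if "u \<in> carrier N" for u
    unfolding s_def using surj[OF that] by (rule someI_ex)
  define \<phi> where "\<phi> u = ?I +>\<^bsub>M\<^esub> s u" for u
  have \<phi>h: "\<phi> (h x) = ?I +>\<^bsub>M\<^esub> x" if "x \<in> carrier M" for x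
  proof -
    have "s (h x) \<in> ?I +>\<^bsub>M\<^esub> x"
      using s[of "h x"] that by (intro h.homeq_imp_rcos) auto
    then show ?thesis
      unfolding \<phi>_def using that I.a_repr_independence' by metis
  qed
  have "\<phi> \<in> ring_iso N ?Q"
  proof (rule ring_iso_memI)
    fix u v assume "u \<in> carrier N" "v \<in> carrier N"
    then obtain x y where xy: "x \<in> carrier M" "y \<in> carrier M" "u = h x" "v = h y"
      by (metis surj)
    show "\<phi> u \<in> carrier ?Q"
      using xy by (auto simp: \<phi>h I.quot_algebra_carrier)
    show "\<phi> (u \<otimes>\<^bsub>N\<^esub> v) = \<phi> u \<otimes>\<^bsub>?Q\<^esub> \<phi> v" "\<phi> (u \<oplus>\<^bsub>N\<^esub> v) = \<phi> u \<oplus>\<^bsub>?Q\<^esub> \<phi> v"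
      using xy \<phi>h[of "x \<otimes>\<^bsub>M\<^esub> y"] \<phi>h[of "x \<oplus>\<^bsub>M\<^esub> y"]
      by (simp_all add: \<phi>h I.quot_algebra_mult I.quot_algebra_add)
  next
    show "\<phi> \<one>\<^bsub>N\<^esub> = \<one>\<^bsub>?Q\<^esub>"
      using \<phi>h[of "\<one>\<^bsub>M\<^esub>"] by (simp add: I.quot_algebra_simps)
    show "bij_betw \<phi> (carrier N) (carrier ?Q)"
    proof (rule bij_betwI')
      fix u v assume "u \<in> carrier N" "v \<in> carrier N"
      then obtain x y where xy: "x \<in> carrier M" "y \<in> carrier M" "u = h x" "v = h y"
        by (metis surj)
      show "\<phi> u = \<phi> v \<longleftrightarrow> u = v"
        using xy \<phi>h h.rcos_imp_homeq I.a_rcos_self by metis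
    next
      fix u assume "u \<in> carrier N"
      then show "\<phi> u \<in> carrier ?Q"
        using s by (auto simp: \<phi>_def I.quot_algebra_carrier)
    next
      fix C assume "C \<in> carrier ?Q"
      then show "\<exists>u\<in>carrier N. C = \<phi> u"
        unfolding I.quot_algebra_carrier by (metis \<phi>h h.hom_closed imageE)
    qed
  qed
  moreover have "\<phi> (r \<odot>\<^bsub>N\<^esub> u) = r \<odot>\<^bsub>?Q\<^esub> \<phi> u" if "r \<in> carrier R" "u \<in> carrier N" for r u
  proof -
    obtain x where "x \<in> carrier M" "u = h x"
      by (metis surj \<open>u \<in> carrier N\<close>)
    then show ?thesis
      using that \<phi>h[of "r \<odot>\<^bsub>M\<^esub> x"] by (simp add: \<phi>h I.quot_algebra_smult lin)
  qed
  ultimately show ?thesis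
    unfolding algebra_isomorphic_def
    using N.assoc_algebra_axioms I.assoc_algebra_quot_algebra by blast
qed

section \<open>Free algebras\<close>

locale scalar_ring =
  fixes B :: "'c::comm_ring_1 set"
  assumes zero_in [simp, intro]: "0 \<in> B" and one_in [simp, intro]: "1 \<in> B"
    and uminus_in [intro]: "p \<in> B \<Longrightarrow> - p \<in> B"
    and add_in [intro]: "p \<in> B \<Longrightarrow> q \<in> B \<Longrightarrow> p + q \<in> B"
    and mult_in [intro]: "p \<in> B \<Longrightarrow> q \<in> B \<Longrightarrow> p * q \<in> B"
begin

lemma sum_in: "(\<And>i. i \<in> A \<Longrightarrow> f i \<in> B) \<Longrightarrow> sum f A \<in> B"
  by (induction A rule: infinite_finite_induct) auto

lemma diff_in [intro]: "p \<in> B \<Longrightarrow> q \<in> B \<Longrightarrow> p - q \<in> B"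
  using add_in[OF _ uminus_in] by fastforce

lemma cring_ring_on: "cring (ring_on B)"
proof (rule cringI)
  have "\<exists>y\<in>B. y + x = 0" if "x \<in> B" for x
    using that uminus_in[OF that] by (intro bexI[of _ "- x"]) auto
  then show "abelian_group (ring_on B)"
    by (intro abelian_groupI) (auto simp: ring_on_def add.assoc add.commute)
  show "Group.comm_monoid (ring_on B)"
    by (rule comm_monoidI) (auto simp: ring_on_def mult.assoc mult.commute)
qed (simp add: ring_on_def distrib_right)

lemma ring_on_simps [simp]:
  "carrier (ring_on B) = B" "mult (ring_on B) = (*)" "one (ring_on B) = 1"
  "zero (ring_on B) = 0" "add (ring_on B) = (+)"
  by (simp_all add: ring_on_def)

end

definition word_mult :: "('v list \<Rightarrow> 'c::comm_ring_1) \<Rightarrow> ('v list \<Rightarrow> 'c) \<Rightarrow> 'v list \<Rightarrow> 'c" where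
  "word_mult f g w = (\<Sum>i\<le>length w. f (take i w) * g (drop i w))"

lemma word_mult_simps [simp]:
  "word_mult f g [] = f [] * g []"
  "word_mult f g (v # w) = f [] * g (v # w) + word_mult (\<lambda>u. f (v # u)) g w"
  by (simp_all add: word_mult_def sum.atMost_Suc_shift del: sum.atMost_Suc)

lemma word_mult_add_left:
  "word_mult (\<lambda>u. f u + g u) h w = word_mult f h w + word_mult g h w"
  by (simp add: word_mult_def distrib_right sum.distrib)

lemma word_mult_add_right:
  "word_mult h (\<lambda>u. f u + g u) w = word_mult h f w + word_mult h g w"
  by (simp add: word_mult_def distrib_left sum.distrib)

lemma word_mult_scale_left: "word_mult (\<lambda>u. r * f u) g w = r * word_mult f g w"
  by (simp add: word_mult_def sum_distrib_left mult.assoc)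

lemma word_mult_scale_right: "word_mult f (\<lambda>u. r * g u) w = r * word_mult f g w"
  by (simp add: word_mult_def sum_distrib_left mult.left_commute)

lemma word_mult_assoc: "word_mult (word_mult f g) h w = word_mult f (word_mult g h) w"
  by (induction w arbitrary: f)
    (simp_all add: word_mult_add_left word_mult_scale_left algebra_simps)

lemma word_mult_zero_left [simp]: "word_mult (\<lambda>u. 0) f w = 0"
  by (simp add: word_mult_def)

lemma word_mult_one_left: "word_mult (\<lambda>w. if w = [] then 1 else 0) f w = f w"
  by (cases w) simp_all

lemma word_mult_one_right: "word_mult f (\<lambda>w. if w = [] then 1 else 0) w = f w"
  by (induction w arbitrary: f) simp_all

lemma word_mult_letter:
  "word_mult (letter v) f w = (case w of [] \<Rightarrow> 0 | u # w' \<Rightarrow> if u = v then f w' else 0)"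
proof (cases w)
  case (Cons u w')
  have "(\<lambda>x. letter v (u # x)) = (\<lambda>w. if u = v then if w = [] then 1 else (0 :: 'a) else 0)"
    by (auto simp: letter_def fun_eq_iff)
  then show ?thesis
    using Cons word_mult_one_left[of f w']
    by (simp add: letter_def)
qed (simp add: letter_def)

lemma finite_support_word_mult:
  assumes "finite {w. f w \<noteq> 0}" "finite {w. g w \<noteq> 0}"
  shows "finite {w. word_mult f g w \<noteq> 0}"
proof (rule finite_subset)
  show "{w. word_mult f g w \<noteq> 0} \<subseteq> (\<lambda>(u, v). u @ v) ` ({w. f w \<noteq> 0} \<times> {w. g w \<noteq> 0})"
  proof
    fix w assume "w \<in> {w. word_mult f g w \<noteq> 0}"
    then obtain i where "f (take i w) * g (drop i w) \<noteq> 0"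
      unfolding word_mult_def by (auto elim: sum.not_neutral_contains_not_neutral)
    then have "f (take i w) \<noteq> 0" "g (drop i w) \<noteq> 0" by auto
    then show "w \<in> (\<lambda>(u, v). u @ v) ` ({w. f w \<noteq> 0} \<times> {w. g w \<noteq> 0})"
      by (intro image_eqI[of _ _ "(take i w, drop i w)"]) simp_all
  qed
  show "finite ((\<lambda>(u, v). u @ v) ` ({w. f w \<noteq> 0} \<times> {w. g w \<noteq> 0}))"
    using assms by simp
qed

lemma free_algebra_simps:
  "carrier (free_algebra B) = {f. finite {w. f w \<noteq> 0} \<and> range f \<subseteq> B}"
  "mult (free_algebra B) = word_mult"
  "one (free_algebra B) = (\<lambda>w. if w = [] then 1 else 0)"
  "zero (free_algebra B) = (\<lambda>w. 0)"
  "add (free_algebra B) = (\<lambda>f g w. f w + g w)"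
  "smult (free_algebra B) = (\<lambda>r f w. r * f w)"
  by (auto simp: free_algebra_def word_mult_def fun_eq_iff)

context scalar_ring
begin

lemma free_algebra_carrierI:
  "finite {w. f w \<noteq> 0} \<Longrightarrow> (\<And>w. f w \<in> B) \<Longrightarrow> f \<in> carrier (free_algebra B)"
  by (auto simp: free_algebra_simps)

lemma free_algebra_carrierD:
  assumes "f \<in> carrier (free_algebra B)"
  shows "finite {w. f w \<noteq> 0}" "f w \<in> B"
  using assms by (auto simp: free_algebra_simps)

lemma
  assumes f: "f \<in> carrier (free_algebra B)" and g: "g \<in> carrier (free_algebra B)"
  shows free_add_closed: "(\<lambda>w. f w + g w) \<in> carrier (free_algebra B)"
    and free_mult_closed: "word_mult f g \<in> carrier (free_algebra B)"
    and free_smult_closed: "r \<in> B \<Longrightarrow> (\<lambda>w. r * f w) \<in> carrier (free_algebra B)"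
proof -
  note fg = free_algebra_carrierD[OF f] free_algebra_carrierD[OF g]
  show "(\<lambda>w. f w + g w) \<in> carrier (free_algebra B)"
  proof (rule free_algebra_carrierI)
    show "finite {w. f w + g w \<noteq> 0}"
      by (rule finite_subset[OF _ finite_UnI[OF fg(1,3)]]) auto
  qed (auto intro: fg)
  show "word_mult f g \<in> carrier (free_algebra B)"
    using fg by (intro free_algebra_carrierI finite_support_word_mult)
      (auto simp: word_mult_def intro!: sum_in)
  show "(\<lambda>w. r * f w) \<in> carrier (free_algebra B)" if "r \<in> B"
  proof (rule free_algebra_carrierI)
    show "finite {w. r * f w \<noteq> 0}"
      by (rule finite_subset[OF _ fg(1)]) auto
  qed (auto intro: fg that)
qed

lemma free_one_closed: "(\<lambda>w. if w = [] then 1 else 0) \<in> carrier (free_algebra B)"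
  by (rule free_algebra_carrierI) auto

lemma letter_closed: "letter v \<in> carrier (free_algebra B)"
  by (rule free_algebra_carrierI) (auto simp: letter_def)

lemma assoc_algebra_free_algebra: "assoc_algebra (ring_on B) (free_algebra B :: ('c, 'v list \<Rightarrow> 'c) module)"
proof -
  let ?F = "free_algebra B :: ('c, 'v list \<Rightarrow> 'c) module"
  have g: "abelian_group ?F"
  proof (rule abelian_groupI)
    fix f assume f: "f \<in> carrier ?F"
    have "(\<lambda>w. - 1 * f w) \<in> carrier ?F"
      using f by (rule free_smult_closed[OF _ f]) auto
    then show "\<exists>g\<in>carrier ?F. g \<oplus>\<^bsub>?F\<^esub> f = \<zero>\<^bsub>?F\<^esub>"
      by (rule bexI[rotated]) (simp add: free_algebra_simps)
  next
    show "\<zero>\<^bsub>?F\<^esub> \<in> carrier ?F"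
      by (simp add: free_algebra_simps)
  next
    fix f g assume "f \<in> carrier ?F" "g \<in> carrier ?F"
    then show "f \<oplus>\<^bsub>?F\<^esub> g \<in> carrier ?F"
      using free_add_closed by (simp add: free_algebra_simps(5))
  qed (simp_all add: free_algebra_simps(4,5) add.assoc add.commute add.left_commute)
  have m: "Group.monoid ?F"
    by (rule monoidI)
      (simp_all add: free_algebra_simps(2,3) free_one_closed free_mult_closed fun_eq_iff
        word_mult_assoc word_mult_one_left word_mult_one_right)
  have r: "ring ?F"
    by (rule ringI[OF g m])
      (simp_all add: free_algebra_simps(2,5) fun_eq_iff word_mult_add_left word_mult_add_right)
  have mo: "Module.module (ring_on B) ?F"
    by (rule moduleI[OF cring_ring_on g])
      (simp_all add: free_algebra_simps(5,6) free_smult_closed algebra_simps)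
  show ?thesis
    by (intro assoc_algebra.intro mo r assoc_algebra_axioms.intro)
      (simp_all add: free_algebra_simps(2,6) fun_eq_iff word_mult_scale_left word_mult_scale_right)
qed

end

lemma letter_mult_word:
  "word_mult (letter v) (\<lambda>w. if w = u then 1 else 0) = (\<lambda>w. if w = v # u then 1 else 0)"
  by (auto simp: fun_eq_iff word_mult_letter split: list.split)

context scalar_ring
begin

lemma free_algebra_induct [consumes 1, case_names one add smult letter]:
  assumes "f \<in> carrier (free_algebra B)"
    and one: "P (\<lambda>w. if w = [] then 1 else 0)"
    and add: "\<And>f g. \<lbrakk>f \<in> carrier (free_algebra B); P f; g \<in> carrier (free_algebra B); P g\<rbrakk> \<Longrightarrow> P (\<lambda>w. f w + g w)"
    and smult: "\<And>r f. \<lbrakk>r \<in> B; f \<in> carrier (free_algebra B); P f\<rbrakk> \<Longrightarrow> P (\<lambda>w. r * f w)"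
    and letter: "\<And>v f. \<lbrakk>f \<in> carrier (free_algebra B); P f\<rbrakk> \<Longrightarrow> P (word_mult (letter v) f)"
  shows "P f"
proof -
  have word_in: "(\<lambda>w. if w = u then 1 else 0) \<in> carrier (free_algebra B)" for u :: "'b list"
    by (rule free_algebra_carrierI) auto
  have word: "P (\<lambda>w. if w = u then 1 else 0)" for u
  proof (induction u)
    case (Cons v u)
    then show ?case
      using letter[OF word_in, of u v] unfolding letter_mult_word by blast
  qed (use one in simp)
  have "P f" if "finite S" "{w. f w \<noteq> 0} = S" "f \<in> carrier (free_algebra B)" for S f
    using that
  proof (induction S arbitrary: f)
    case empty
    then have "f = (\<lambda>w. 0 * (if w = [] then 1 else 0))" by auto
    then show ?case using smult[OF zero_in free_one_closed one] by simp
  next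
    case (insert u S)
    define g where "g = f(u := 0)"
    have supp: "{w. g w \<noteq> 0} = S"
      using insert.hyps insert.prems(1) by (auto simp: g_def)
    have g: "g \<in> carrier (free_algebra B)"
      by (rule free_algebra_carrierI)
        (use supp insert.hyps free_algebra_carrierD[OF insert.prems(2)] in \<open>auto simp: g_def\<close>)
    have fu: "f u \<in> B"
      by (rule free_algebra_carrierD[OF insert.prems(2)])
    have "P (\<lambda>w. g w + f u * (if w = u then 1 else 0))"
      by (intro add g insert.IH[OF supp g] free_smult_closed[OF word_in word_in fu]
          smult[OF fu word_in word])
    moreover have "(\<lambda>w. g w + f u * (if w = u then 1 else 0)) = f"
      by (auto simp: g_def)
    ultimately show ?case by simp
  qed
  then show ?thesis
    using assms(1) free_algebra_carrierD(1) by blast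
qed

end

locale free_algebra_lift = scalar_ring B + N?: assoc_algebra "ring_on B" N
  for B :: "'c::comm_ring_1 set" and N :: "('c, 'a) module" +
  fixes e :: "'v \<Rightarrow> 'a"
  assumes e_closed [simp, intro]: "e v \<in> carrier N"
begin

abbreviation word_prod :: "'v list \<Rightarrow> 'a" where
  "word_prod w \<equiv> foldr (\<lambda>v a. e v \<otimes>\<^bsub>N\<^esub> a) w \<one>\<^bsub>N\<^esub>"

definition lift :: "('v list \<Rightarrow> 'c) \<Rightarrow> 'a" where
  "lift f = finsum N (\<lambda>w. f w \<odot>\<^bsub>N\<^esub> word_prod w) {w. f w \<noteq> 0}"

lemma word_prod_closed [simp, intro]: "word_prod w \<in> carrier N"
  by (induction w) auto

lemma N_smult_closed [intro]: "r \<in> B \<Longrightarrow> x \<in> carrier N \<Longrightarrow> r \<odot>\<^bsub>N\<^esub> x \<in> carrier N"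
  using N.smult_closed[of r x] by simp

lemma lift_superset:
  assumes "f \<in> carrier (free_algebra B)" "finite S" "{w. f w \<noteq> 0} \<subseteq> S"
  shows "lift f = finsum N (\<lambda>w. f w \<odot>\<^bsub>N\<^esub> word_prod w) S"
  unfolding lift_def
  by (rule M.add.finprod_mono_neutral_cong_left)
    (use assms N.smult_l_null free_algebra_carrierD[OF assms(1)] in auto)

lemma lift_closed [simp, intro]:
  assumes "f \<in> carrier (free_algebra B)"
  shows "lift f \<in> carrier N"
  unfolding lift_def by (rule M.finsum_closed) (use free_algebra_carrierD[OF assms] in auto)

lemma lift_add:
  assumes f: "f \<in> carrier (free_algebra B)" and g: "g \<in> carrier (free_algebra B)"
  shows "lift (\<lambda>w. f w + g w) = lift f \<oplus>\<^bsub>N\<^esub> lift g"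
proof -
  let ?S = "{w. f w \<noteq> 0} \<union> {w. g w \<noteq> 0}"
  note fg = free_algebra_carrierD[OF f] free_algebra_carrierD[OF g]
  have S: "finite ?S" using fg by simp
  have "lift (\<lambda>w. f w + g w) = finsum N (\<lambda>w. (f w + g w) \<odot>\<^bsub>N\<^esub> word_prod w) ?S"
    by (rule lift_superset[OF free_add_closed[OF f g] S]) auto
  also have "\<dots> = finsum N (\<lambda>w. f w \<odot>\<^bsub>N\<^esub> word_prod w \<oplus>\<^bsub>N\<^esub> g w \<odot>\<^bsub>N\<^esub> word_prod w) ?S"
    by (rule M.finsum_cong') (use fg N.smult_l_distr in auto)
  also have "\<dots> = lift f \<oplus>\<^bsub>N\<^esub> lift g"
    using lift_superset[OF f S] lift_superset[OF g S] fg by (subst M.finsum_addf) auto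
  finally show ?thesis .
qed

lemma lift_smult:
  assumes f: "f \<in> carrier (free_algebra B)" and r: "r \<in> B"
  shows "lift (\<lambda>w. r * f w) = r \<odot>\<^bsub>N\<^esub> lift f"
proof -
  let ?S = "{w. f w \<noteq> 0}"
  note fD = free_algebra_carrierD[OF f]
  have "lift (\<lambda>w. r * f w) = finsum N (\<lambda>w. (r * f w) \<odot>\<^bsub>N\<^esub> word_prod w) ?S"
    by (rule lift_superset[OF free_smult_closed[OF f f r] fD(1)]) auto
  also have "\<dots> = finsum N (\<lambda>w. r \<odot>\<^bsub>N\<^esub> (f w \<odot>\<^bsub>N\<^esub> word_prod w)) ?S"
    by (rule M.finsum_cong') (use fD r N.smult_assoc1 in auto)
  also have "\<dots> = r \<odot>\<^bsub>N\<^esub> lift f"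
    unfolding lift_def by (rule N.finsum_smult_ldistr[symmetric]) (use fD r in auto)
  finally show ?thesis .
qed

lemma lift_one: "lift (\<lambda>w. if w = [] then 1 else 0) = \<one>\<^bsub>N\<^esub>"
proof -
  have "lift (\<lambda>w. if w = [] then 1 else 0)
      = finsum N (\<lambda>w. (if w = [] then 1 else 0) \<odot>\<^bsub>N\<^esub> word_prod w) {[]}"
    by (rule lift_superset[OF free_one_closed]) auto
  then show ?thesis
    using N.smult_one[of "\<one>\<^bsub>N\<^esub>"] by (simp add: M.finsum_insert)
qed

lemma lift_letter_mult:
  assumes f: "f \<in> carrier (free_algebra B)"
  shows "lift (word_mult (letter v) f) = e v \<otimes>\<^bsub>N\<^esub> lift f"
proof -
  let ?S = "{w. f w \<noteq> 0}"
  note fD = free_algebra_carrierD[OF f]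
  have cons: "word_mult (letter v) f (v # w) = f w" for w
    unfolding word_mult_letter by simp
  have "{w. word_mult (letter v) f w \<noteq> 0} \<subseteq> (#) v ` ?S"
  proof
    fix w assume "w \<in> {w. word_mult (letter v) f w \<noteq> 0}"
    then show "w \<in> (#) v ` ?S"
      by (cases w) (auto simp: word_mult_letter split: if_splits)
  qed
  then have "lift (word_mult (letter v) f)
      = finsum N (\<lambda>w. word_mult (letter v) f w \<odot>\<^bsub>N\<^esub> word_prod w) ((#) v ` ?S)"
    using fD by (intro lift_superset[OF free_mult_closed[OF letter_closed f]]) auto
  also have "\<dots> = finsum N (\<lambda>w. word_mult (letter v) f (v # w) \<odot>\<^bsub>N\<^esub> word_prod (v # w)) ?S"
    by (rule M.finsum_reindex) (use fD cons in \<open>auto simp del: word_mult_simps\<close>)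
  also have "\<dots> = finsum N (\<lambda>w. e v \<otimes>\<^bsub>N\<^esub> (f w \<odot>\<^bsub>N\<^esub> word_prod w)) ?S"
  proof (rule M.finsum_cong')
    show "word_mult (letter v) f (v # w) \<odot>\<^bsub>N\<^esub> word_prod (v # w)
        = e v \<otimes>\<^bsub>N\<^esub> (f w \<odot>\<^bsub>N\<^esub> word_prod w)" for w
      unfolding cons using fD N.smult_mult_right[of "f w" "e v" "word_prod w"] by simp
  qed (use fD in auto)
  also have "\<dots> = e v \<otimes>\<^bsub>N\<^esub> lift f"
    unfolding lift_def by (rule N.finsum_rdistr[symmetric]) (use fD in auto)
  finally show ?thesis .
qed

lemma lift_letter: "lift (letter v) = e v"
proof -
  have "word_mult (letter v) (\<lambda>w. if w = [] then 1 else 0) = (letter v :: _ \<Rightarrow> 'c)"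
    by (simp add: fun_eq_iff word_mult_one_right)
  with lift_letter_mult[OF free_one_closed, of v] show ?thesis
    by (simp add: lift_one)
qed

lemma lift_mult:
  assumes "f \<in> carrier (free_algebra B)" and g: "g \<in> carrier (free_algebra B)"
  shows "lift (word_mult f g) = lift f \<otimes>\<^bsub>N\<^esub> lift g"
  using assms(1)
proof (induction rule: free_algebra_induct)
  case one
  have "word_mult (\<lambda>w. if w = [] then 1 else 0) g = g"
    by (simp add: fun_eq_iff word_mult_one_left)
  then show ?case
    using g by (simp add: lift_one)
next
  case (add f f')
  have "word_mult (\<lambda>w. f w + f' w) g = (\<lambda>w. word_mult f g w + word_mult f' g w)"
    by (simp add: fun_eq_iff word_mult_add_left)
  then show ?case
    using add g by (simp add: lift_add free_mult_closed N.l_distr)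
next
  case (smult r f)
  have "word_mult (\<lambda>w. r * f w) g = (\<lambda>w. r * word_mult f g w)"
    by (simp add: fun_eq_iff word_mult_scale_left)
  then show ?case
    using smult g N.smult_mult_left[of r "lift f" "lift g"] by (simp add: lift_smult free_mult_closed)
next
  case (letter v f)
  have "word_mult (word_mult (letter v) f) g = word_mult (letter v) (word_mult f g)"
    by (simp add: fun_eq_iff word_mult_assoc)
  then show ?case
    using letter g by (simp add: lift_letter_mult free_mult_closed N.m_assoc)
qed

lemma lift_ring_hom: "lift \<in> ring_hom (free_algebra B) N"
  by (rule ring_hom_memI)
    (simp_all add: free_algebra_simps(2,3,5) lift_mult lift_add lift_one)

end

section \<open>Algebras on two quadratic generators\<close>

definition lin_comb :: "('r, 'a) module \<Rightarrow> 'a \<Rightarrow> 'a \<Rightarrow> 'r \<Rightarrow> 'r \<Rightarrow> 'r \<Rightarrow> 'r \<Rightarrow> 'a" where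
  "lin_comb M x y c0 c1 c2 c3 =
    (c0 \<odot>\<^bsub>M\<^esub> \<one>\<^bsub>M\<^esub> \<oplus>\<^bsub>M\<^esub> c1 \<odot>\<^bsub>M\<^esub> x) \<oplus>\<^bsub>M\<^esub> (c2 \<odot>\<^bsub>M\<^esub> y \<oplus>\<^bsub>M\<^esub> c3 \<odot>\<^bsub>M\<^esub> (x \<otimes>\<^bsub>M\<^esub> y))"

locale clifford_pair = assoc_algebra R M
  for R :: "('r, 'm) ring_scheme" (structure) and M :: "('r, 'a) module" (structure) +
  fixes x y :: 'a and p q r :: 'r
  assumes x_closed [simp, intro]: "x \<in> carrier M" and y_closed [simp, intro]: "y \<in> carrier M"
    and p_closed [simp, intro]: "p \<in> carrier R" and q_closed [simp, intro]: "q \<in> carrier R"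
    and r_closed [simp, intro]: "r \<in> carrier R"
    and xx: "x \<otimes>\<^bsub>M\<^esub> x = p \<odot>\<^bsub>M\<^esub> \<one>\<^bsub>M\<^esub>"
    and yy: "y \<otimes>\<^bsub>M\<^esub> y = q \<odot>\<^bsub>M\<^esub> \<one>\<^bsub>M\<^esub>"
    and xy_yx: "x \<otimes>\<^bsub>M\<^esub> y \<oplus>\<^bsub>M\<^esub> y \<otimes>\<^bsub>M\<^esub> x = r \<odot>\<^bsub>M\<^esub> \<one>\<^bsub>M\<^esub>"
begin

abbreviation comb :: "'r \<Rightarrow> 'r \<Rightarrow> 'r \<Rightarrow> 'r \<Rightarrow> 'a" where
  "comb \<equiv> lin_comb M x y"

lemma comb_closed [simp, intro]:
  "\<lbrakk>c0 \<in> carrier R; c1 \<in> carrier R; c2 \<in> carrier R; c3 \<in> carrier R\<rbrakk>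
    \<Longrightarrow> comb c0 c1 c2 c3 \<in> carrier M"
  by (simp add: lin_comb_def)

lemma comb_add:
  "\<lbrakk>c0 \<in> carrier R; c1 \<in> carrier R; c2 \<in> carrier R; c3 \<in> carrier R;
    d0 \<in> carrier R; d1 \<in> carrier R; d2 \<in> carrier R; d3 \<in> carrier R\<rbrakk>
    \<Longrightarrow> comb c0 c1 c2 c3 \<oplus>\<^bsub>M\<^esub> comb d0 d1 d2 d3
      = comb (c0 \<oplus>\<^bsub>R\<^esub> d0) (c1 \<oplus>\<^bsub>R\<^esub> d1) (c2 \<oplus>\<^bsub>R\<^esub> d2) (c3 \<oplus>\<^bsub>R\<^esub> d3)"
  by (simp add: lin_comb_def smult_l_distr M.a_ac)

lemma comb_smult:
  "\<lbrakk>c0 \<in> carrier R; c1 \<in> carrier R; c2 \<in> carrier R; c3 \<in> carrier R; s \<in> carrier R\<rbrakk>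
    \<Longrightarrow> s \<odot>\<^bsub>M\<^esub> comb c0 c1 c2 c3
      = comb (s \<otimes>\<^bsub>R\<^esub> c0) (s \<otimes>\<^bsub>R\<^esub> c1) (s \<otimes>\<^bsub>R\<^esub> c2) (s \<otimes>\<^bsub>R\<^esub> c3)"
  by (simp add: lin_comb_def smult_r_distr smult_assoc1)

lemma x_mult_comb:
  assumes "c0 \<in> carrier R" "c1 \<in> carrier R" "c2 \<in> carrier R" "c3 \<in> carrier R"
  shows "x \<otimes>\<^bsub>M\<^esub> comb c0 c1 c2 c3 = comb (c1 \<otimes>\<^bsub>R\<^esub> p) c0 (c3 \<otimes>\<^bsub>R\<^esub> p) c2"
proof -
  have "x \<otimes>\<^bsub>M\<^esub> (x \<otimes>\<^bsub>M\<^esub> y) = p \<odot>\<^bsub>M\<^esub> y"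
    by (simp add: xx smult_mult_left flip: m_assoc)
  then show ?thesis
    using assms
    by (simp add: lin_comb_def r_distr smult_mult_right smult_assoc1 xx M.a_ac)
qed

lemma y_mult_comb:
  assumes "c0 \<in> carrier R" "c1 \<in> carrier R" "c2 \<in> carrier R" "c3 \<in> carrier R"
  shows "y \<otimes>\<^bsub>M\<^esub> comb c0 c1 c2 c3
    = comb (c1 \<otimes>\<^bsub>R\<^esub> r \<oplus>\<^bsub>R\<^esub> c2 \<otimes>\<^bsub>R\<^esub> q) (\<ominus>\<^bsub>R\<^esub> (c3 \<otimes>\<^bsub>R\<^esub> q))
        (c0 \<oplus>\<^bsub>R\<^esub> c3 \<otimes>\<^bsub>R\<^esub> r) (\<ominus>\<^bsub>R\<^esub> c1)"
proof -
  have yx: "y \<otimes>\<^bsub>M\<^esub> x = r \<odot>\<^bsub>M\<^esub> \<one>\<^bsub>M\<^esub> \<oplus>\<^bsub>M\<^esub> \<ominus>\<^bsub>M\<^esub> (x \<otimes>\<^bsub>M\<^esub> y)"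
    using M.r_neg1[of "x \<otimes>\<^bsub>M\<^esub> y" "y \<otimes>\<^bsub>M\<^esub> x"] by (simp add: M.a_comm flip: xy_yx)
  have "y \<otimes>\<^bsub>M\<^esub> (x \<otimes>\<^bsub>M\<^esub> y) = r \<odot>\<^bsub>M\<^esub> y \<oplus>\<^bsub>M\<^esub> \<ominus>\<^bsub>M\<^esub> (q \<odot>\<^bsub>M\<^esub> x)"
    by (simp add: yx yy l_distr l_minus smult_mult_left smult_mult_right m_assoc
        flip: m_assoc[of y x y])
  then show ?thesis
    using assms yx
    by (simp add: lin_comb_def r_distr smult_mult_right smult_assoc1 smult_r_distr smult_l_distr
        smult_r_minus smult_l_minus yy M.a_ac)
qed

definition combs :: "'a set" where
  "combs = {comb c0 c1 c2 c3 | c0 c1 c2 c3.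
    c0 \<in> carrier R \<and> c1 \<in> carrier R \<and> c2 \<in> carrier R \<and> c3 \<in> carrier R}"

lemma combsI:
  "\<lbrakk>c0 \<in> carrier R; c1 \<in> carrier R; c2 \<in> carrier R; c3 \<in> carrier R\<rbrakk> \<Longrightarrow> comb c0 c1 c2 c3 \<in> combs"
  unfolding combs_def by blast

lemma combsE:
  assumes "u \<in> combs"
  obtains c0 c1 c2 c3 where "c0 \<in> carrier R" "c1 \<in> carrier R" "c2 \<in> carrier R" "c3 \<in> carrier R"
    "u = comb c0 c1 c2 c3"
  using assms unfolding combs_def by blast

lemma one_in_combs: "\<one>\<^bsub>M\<^esub> \<in> combs"
proof -
  have "comb \<one>\<^bsub>R\<^esub> \<zero>\<^bsub>R\<^esub> \<zero>\<^bsub>R\<^esub> \<zero>\<^bsub>R\<^esub> = \<one>\<^bsub>M\<^esub>"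
    by (simp add: lin_comb_def)
  then show ?thesis
    using combsI[of "\<one>\<^bsub>R\<^esub>" "\<zero>\<^bsub>R\<^esub>" "\<zero>\<^bsub>R\<^esub>" "\<zero>\<^bsub>R\<^esub>"] by simp
qed

lemma add_in_combs: "u \<in> combs \<Longrightarrow> v \<in> combs \<Longrightarrow> u \<oplus>\<^bsub>M\<^esub> v \<in> combs"
  by (elim combsE) (simp add: comb_add combsI)

lemma smult_in_combs: "s \<in> carrier R \<Longrightarrow> u \<in> combs \<Longrightarrow> s \<odot>\<^bsub>M\<^esub> u \<in> combs"
  by (elim combsE) (simp add: comb_smult combsI)

lemma x_mult_in_combs: "u \<in> combs \<Longrightarrow> x \<otimes>\<^bsub>M\<^esub> u \<in> combs"
  by (elim combsE) (simp add: x_mult_comb combsI)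

lemma y_mult_in_combs: "u \<in> combs \<Longrightarrow> y \<otimes>\<^bsub>M\<^esub> u \<in> combs"
  by (elim combsE) (simp add: y_mult_comb combsI)

end

theorem algebra_isomorphic_two_gen_algebra:
  fixes N :: "('c::comm_ring_1, 'a) module"
  assumes B: "scalar_ring B" and cp: "clifford_pair (ring_on B) N x y p q r"
    and span: "\<And>u. u \<in> carrier N \<Longrightarrow>
      \<exists>c0\<in>B. \<exists>c1\<in>B. \<exists>c2\<in>B. \<exists>c3\<in>B. u = lin_comb N x y c0 c1 c2 c3"
    and indep: "\<And>c0 c1 c2 c3. \<lbrakk>c0 \<in> B; c1 \<in> B; c2 \<in> B; c3 \<in> B; lin_comb N x y c0 c1 c2 c3 = \<zero>\<^bsub>N\<^esub>\<rbrakk>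
      \<Longrightarrow> c0 = 0 \<and> c1 = 0 \<and> c2 = 0 \<and> c3 = 0"
  shows "algebra_isomorphic (ring_on B) N (two_gen_algebra B p q r)"
proof -
  interpret scalar_ring B by fact
  interpret N: clifford_pair "ring_on B" N x y p q r by fact
  let ?e = "case_gen x y"
  have e: "?e v \<in> carrier N" for v by (cases v) auto
  interpret L: free_algebra_lift B N ?e
    by (intro free_algebra_lift.intro B N.assoc_algebra_axioms free_algebra_lift_axioms.intro e)
  let ?F = "free_algebra B :: ('c, gen list \<Rightarrow> 'c) module"
  let ?\<xi> = "letter Xi" and ?\<eta> = "letter Eta"
  interpret F: assoc_algebra "ring_on B" ?F by (rule assoc_algebra_free_algebra)
  interpret h: ring_hom_ring ?F N L.lift
    by (rule ring_hom_ringI2[OF F.ring_axioms N.ring_axioms L.lift_ring_hom])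
  have pqr: "p \<in> B" "q \<in> B" "r \<in> B"
    using N.p_closed N.q_closed N.r_closed by simp_all
  have letters: "letter v \<in> carrier ?F" for v by (rule letter_closed)
  have h_letter: "L.lift ?\<xi> = x" "L.lift ?\<eta> = y"
    by (simp_all add: L.lift_letter)
  have h_smult: "L.lift (s \<odot>\<^bsub>?F\<^esub> f) = s \<odot>\<^bsub>N\<^esub> L.lift f" if "s \<in> B" "f \<in> carrier ?F" for s f
    using that by (simp add: free_algebra_simps(6) L.lift_smult)
  have F_smult: "s \<odot>\<^bsub>?F\<^esub> f \<in> carrier ?F" if "s \<in> B" "f \<in> carrier ?F" for s f
    using F.smult_closed[of s f] that by simp
  define S where "S = {?\<xi> \<otimes>\<^bsub>?F\<^esub> ?\<xi> \<ominus>\<^bsub>?F\<^esub> p \<odot>\<^bsub>?F\<^esub> \<one>\<^bsub>?F\<^esub>, ?\<eta> \<otimes>\<^bsub>?F\<^esub> ?\<eta> \<ominus>\<^bsub>?F\<^esub> q \<odot>\<^bsub>?F\<^esub> \<one>\<^bsub>?F\<^esub>,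
    ?\<xi> \<otimes>\<^bsub>?F\<^esub> ?\<eta> \<oplus>\<^bsub>?F\<^esub> ?\<eta> \<otimes>\<^bsub>?F\<^esub> ?\<xi> \<ominus>\<^bsub>?F\<^esub> r \<odot>\<^bsub>?F\<^esub> \<one>\<^bsub>?F\<^esub>}"
  define I where "I = Idl\<^bsub>?F\<^esub> S"
  have S: "S \<subseteq> carrier ?F"
    using pqr by (auto simp: S_def letters F_smult)
  have I: "ideal I ?F"
    unfolding I_def by (rule F.genideal_ideal[OF S])
  interpret I: algebra_ideal "ring_on B" ?F I
    by (rule algebra_ideal.intro[OF F.assoc_algebra_axioms I])
  let ?Q = "quot_algebra ?F I"
  let ?k = "\<lambda>f. I +>\<^bsub>?F\<^esub> f"
  have SI: "S \<subseteq> I"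
    unfolding I_def by (rule F.genideal_self[OF S])
  have rel: "?k f = ?k g" if "f \<ominus>\<^bsub>?F\<^esub> g \<in> S" "f \<in> carrier ?F" "g \<in> carrier ?F" for f g
    using that SI F.quotient_eq_iff_same_a_r_cos[OF I] by blast
  interpret Q: clifford_pair "ring_on B" ?Q "?k ?\<xi>" "?k ?\<eta>" p q r
  proof (intro clifford_pair.intro I.assoc_algebra_quot_algebra clifford_pair_axioms.intro)
    show "?k ?\<xi> \<in> carrier ?Q" "?k ?\<eta> \<in> carrier ?Q"
      by (auto simp: I.quot_algebra_carrier letters)
    show "?k ?\<xi> \<otimes>\<^bsub>?Q\<^esub> ?k ?\<xi> = p \<odot>\<^bsub>?Q\<^esub> \<one>\<^bsub>?Q\<^esub>"
      using rel[of "?\<xi> \<otimes>\<^bsub>?F\<^esub> ?\<xi>" "p \<odot>\<^bsub>?F\<^esub> \<one>\<^bsub>?F\<^esub>"] pqr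
      by (simp add: I.quot_algebra_mult I.quot_algebra_smult I.quot_algebra_simps(3) letters F_smult S_def)
    show "?k ?\<eta> \<otimes>\<^bsub>?Q\<^esub> ?k ?\<eta> = q \<odot>\<^bsub>?Q\<^esub> \<one>\<^bsub>?Q\<^esub>"
      using rel[of "?\<eta> \<otimes>\<^bsub>?F\<^esub> ?\<eta>" "q \<odot>\<^bsub>?F\<^esub> \<one>\<^bsub>?F\<^esub>"] pqr
      by (simp add: I.quot_algebra_mult I.quot_algebra_smult I.quot_algebra_simps(3) letters F_smult S_def)
    show "?k ?\<xi> \<otimes>\<^bsub>?Q\<^esub> ?k ?\<eta> \<oplus>\<^bsub>?Q\<^esub> ?k ?\<eta> \<otimes>\<^bsub>?Q\<^esub> ?k ?\<xi> = r \<odot>\<^bsub>?Q\<^esub> \<one>\<^bsub>?Q\<^esub>"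
      using rel[of "?\<xi> \<otimes>\<^bsub>?F\<^esub> ?\<eta> \<oplus>\<^bsub>?F\<^esub> ?\<eta> \<otimes>\<^bsub>?F\<^esub> ?\<xi>" "r \<odot>\<^bsub>?F\<^esub> \<one>\<^bsub>?F\<^esub>"] pqr
      by (simp add: I.quot_algebra_mult I.quot_algebra_add I.quot_algebra_smult
          I.quot_algebra_simps(3) letters F_smult S_def)
  qed (simp_all add: pqr)
  define nf where "nf = lin_comb ?F ?\<xi> ?\<eta>"
  have nf: "nf c0 c1 c2 c3 \<in> carrier ?F" "?k (nf c0 c1 c2 c3) = Q.comb c0 c1 c2 c3"
    "L.lift (nf c0 c1 c2 c3) = N.comb c0 c1 c2 c3"
    if "c0 \<in> B" "c1 \<in> B" "c2 \<in> B" "c3 \<in> B" for c0 c1 c2 c3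
    using that
    by (simp_all add: nf_def lin_comb_def letters F_smult h_letter h_smult I.quot_algebra_mult
        I.quot_algebra_add I.quot_algebra_smult I.quot_algebra_simps(3))
  have I_ker: "I \<subseteq> a_kernel ?F N L.lift"
    unfolding I_def
  proof (rule F.genideal_minimal[OF h.kernel_is_ideal])
    have diff: "f \<ominus>\<^bsub>?F\<^esub> g \<in> a_kernel ?F N L.lift"
      if "L.lift f = L.lift g" "f \<in> carrier ?F" "g \<in> carrier ?F" for f g
    proof -
      have "L.lift (f \<ominus>\<^bsub>?F\<^esub> g) = L.lift f \<oplus>\<^bsub>N\<^esub> \<ominus>\<^bsub>N\<^esub> L.lift g"
        using that(2,3) by (simp add: a_minus_def)
      also have "\<dots> = \<zero>\<^bsub>N\<^esub>"
        unfolding that(1) using that(3) by (simp add: N.M.r_neg)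
      finally show ?thesis
        unfolding a_kernel_def' using F.minus_closed[OF that(2,3)] by blast
    qed
    show "S \<subseteq> a_kernel ?F N L.lift"
      unfolding S_def using pqr
      by (intro insert_subsetI empty_subsetI diff)
        (simp_all add: letters F_smult h_smult h_letter N.xx N.yy N.xy_yx)
  qed
  have normal: "?k f \<in> Q.combs" if "f \<in> carrier ?F" for f
    using that
  proof (induction rule: free_algebra_induct)
    case one
    show ?case
      using Q.one_in_combs by (simp add: I.quot_algebra_simps(3) free_algebra_simps(3))
  next
    case (add f g)
    then show ?case
      using Q.add_in_combs[of "?k f" "?k g"] I.quot_algebra_add[of f g]
      by (simp add: free_algebra_simps(5))
  next
    case (smult s f)
    then show ?case
      using Q.smult_in_combs[of s "?k f"] I.quot_algebra_smult[of f s]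
      by (simp add: free_algebra_simps(6))
  next
    case (letter v f)
    have "?k (word_mult (letter v) f) = ?k (letter v) \<otimes>\<^bsub>?Q\<^esub> ?k f"
      using I.quot_algebra_mult[OF letters letter(1), of v] by (simp add: free_algebra_simps(2))
    then show ?case
      using Q.x_mult_in_combs[OF letter(2)] Q.y_mult_in_combs[OF letter(2)]
      by (cases v) simp_all
  qed
  have ker: "a_kernel ?F N L.lift = I"
  proof
    show "a_kernel ?F N L.lift \<subseteq> I"
    proof
      fix f assume "f \<in> a_kernel ?F N L.lift"
      then have f: "f \<in> carrier ?F" "L.lift f = \<zero>\<^bsub>N\<^esub>"
        unfolding a_kernel_def' by blast+
      obtain c0 c1 c2 c3 where c: "c0 \<in> B" "c1 \<in> B" "c2 \<in> B" "c3 \<in> B"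
        and kf: "?k f = Q.comb c0 c1 c2 c3"
        using normal[OF f(1)] by (elim Q.combsE) simp
      have "f \<ominus>\<^bsub>?F\<^esub> nf c0 c1 c2 c3 \<in> I"
        using F.quotient_eq_iff_same_a_r_cos[OF I f(1) nf(1)[OF c]] nf(2)[OF c] kf by simp
      then have "L.lift (f \<ominus>\<^bsub>?F\<^esub> nf c0 c1 c2 c3) = \<zero>\<^bsub>N\<^esub>"
        using I_ker unfolding a_kernel_def' by blast
      then have "\<ominus>\<^bsub>N\<^esub> N.comb c0 c1 c2 c3 = \<zero>\<^bsub>N\<^esub>"
        using f nf(1,3)[OF c] c by (simp add: a_minus_def)
      then have "N.comb c0 c1 c2 c3 = \<zero>\<^bsub>N\<^esub>"
        using c N.comb_closed[of c0 c1 c2 c3] N.M.minus_minus[of "N.comb c0 c1 c2 c3"] by simp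
      then have "Q.comb c0 c1 c2 c3 = Q.comb 0 0 0 0"
        using indep[OF c] by simp
      also have "\<dots> = ?k \<zero>\<^bsub>?F\<^esub>"
        using nf(2)[of 0 0 0 0] by (simp add: nf_def lin_comb_def free_algebra_simps)
      finally have "f \<ominus>\<^bsub>?F\<^esub> \<zero>\<^bsub>?F\<^esub> \<in> I"
        using F.quotient_eq_iff_same_a_r_cos[OF I f(1) F.zero_closed] kf by simp
      then show "f \<in> I"
        using f(1) by (simp add: a_minus_def)
    qed
  qed (rule I_ker)
  have surj: "L.lift ` carrier ?F = carrier N"
  proof
    show "carrier N \<subseteq> L.lift ` carrier ?F"
    proof
      fix u assume "u \<in> carrier N"
      then obtain c0 c1 c2 c3 where c: "c0 \<in> B" "c1 \<in> B" "c2 \<in> B" "c3 \<in> B"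
        and u: "u = N.comb c0 c1 c2 c3"
        using span by metis
      show "u \<in> L.lift ` carrier ?F"
        unfolding u nf(3)[OF c, symmetric] by (rule imageI[OF nf(1)[OF c]])
    qed
  qed auto
  show ?thesis
    using algebra_isomorphic_quot_kernel[OF F.assoc_algebra_axioms N.assoc_algebra_axioms
        L.lift_ring_hom surj] h_smult
    by (simp add: ker I_def S_def two_gen_algebra_def Let_def)
qed

section \<open>The generic cocycle of the Sweedler algebra\<close>

lemma kconst_1 [simp]: "kconst 1 = 1"
  and kconst_add: "kconst (r + s) = kconst r + kconst s"
  and kconst_mult [simp]: "kconst (r * s) = kconst r * kconst s"
  and kconst_0 [simp]: "kconst 0 = 0"
  by (simp_all add: kconst_def single_add mult_single flip: to_fract_mult)

lemma kconst_uminus [simp]: "kconst (- r) = - kconst r"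
  using kconst_add[of "- r" r] by (simp add: eq_neg_iff_add_eq_0)

lemma scalar_ring_B_set: "scalar_ring (B_set \<alpha>)"
proof
  show "0 \<in> B_set \<alpha>" "1 \<in> B_set \<alpha>"
    unfolding B_set_def using subalg.scalar[of 0] subalg.scalar[of 1] by simp_all
  show "- p \<in> B_set \<alpha>" if "p \<in> B_set \<alpha>" for p
    using subalg.mult[OF subalg.scalar[of "- 1"] that[unfolded B_set_def]]
    by (simp add: B_set_def)
qed (auto simp: B_set_def intro: subalg.add subalg.mult)

lemma bilin_ext_bas: "bilin_ext s (bas g) (bas h) = s g h"
  by (cases g; cases h) (simp_all add: bilin_ext_def UNIV_h4 bas_def)

lemma sigma_in_B: "sigma_bas \<alpha> g h \<in> B_set \<alpha>"
proof -
  have "bilin_ext (sigma_bas \<alpha>) (bas g) (bas h) \<in> B_set \<alpha>"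
    unfolding B_set_def by (rule subalg.gen) blast
  then show ?thesis
    by (simp only: bilin_ext_bas)
qed

lemma sigma_inv_in_B: "sigma_inv_bas \<alpha> g h \<in> B_set \<alpha>"
proof -
  have "bilin_ext (sigma_inv_bas \<alpha>) (bas g) (bas h) \<in> B_set \<alpha>"
    unfolding B_set_def by (rule subalg.gen) blast
  then show ?thesis
    by (simp only: bilin_ext_bas)
qed

lemma comul2_sum:
  "(\<Sum>i\<in>UNIV. \<Sum>j\<in>UNIV. \<Sum>l\<in>UNIV. comul2 h i j l * F i j l) = (case h of
      H1 \<Rightarrow> F H1 H1 H1 | HX \<Rightarrow> F HX HX HX
    | HY \<Rightarrow> F H1 H1 HY + F H1 HY HX + F HY HX HX
    | HZ \<Rightarrow> F HX HX HZ + F HX HZ H1 + F HZ H1 H1)"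
  by (cases h) (simp_all add: UNIV_h4 comul2_def bas_def tens_def)

lemma sigma_bas_eq:
  "sigma_bas \<alpha> g h =
    (\<Sum>g1\<in>UNIV. \<Sum>g2\<in>UNIV. \<Sum>g3\<in>UNIV. comul2 g g1 g2 g3 *
      (\<Sum>h1\<in>UNIV. \<Sum>h2\<in>UNIV. \<Sum>h3\<in>UNIV. comul2 h h1 h2 h3 *
        (tv g1 * tv h1 * kconst (\<alpha> g2 h2) * (\<Sum>m\<in>UNIV. hmul g3 h3 m * tv_inv m))))"
  by (simp only: sigma_bas_def sum_distrib_left mult.assoc)

lemma sigma_values:
  fixes a b c :: "'k::field"
  defines "s \<equiv> sigma_bas (cocycle a b c)"
  shows "s H1 H1 = tv H1" "s H1 HX = tv H1" "s H1 HY = 0" "s H1 HZ = 0"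
    "s HX H1 = tv H1" "s HY H1 = 0" "s HZ H1 = 0"
    "s HX HX = X2 a / tv H1"
    "s HX HY = - tv HZ + kconst a * tv HX * tv HY / tv H1"
    "s HX HZ = - s HX HY"
    "s HY HX = tv HZ + kconst b * tv HX + kconst a * tv HX * tv HY / tv H1"
    "s HY HY = Y2 a b c / tv H1" "s HY HZ = - (Y2 a b c / tv H1)"
    "s HZ HX = s HY HX" "s HZ HY = Y2 a b c / tv H1"
    "s HZ HZ = (s HX HY * s HY HX - s HX HX * s HY HY) / tv H1"
  unfolding s_def sigma_bas_eq comul2_sum
  by (simp_all add: UNIV_h4 bas_def tv_inv_values X2_def Y2_def tv_nonzero field_simps power2_eq_square)

lemma inverse_tv_in_B:
  assumes "a \<noteq> 0"
  shows "1 / tv H1 \<in> B_set (cocycle a b c)"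
proof -
  have "sigma_inv_bas (cocycle a b c) H1 H1 = 1 / tv H1"
    using assms
    by (simp add: sigma_inv_bas_def UNIV_h4 bas_def comul2_def tens_def tv_inv_values
        conv_inv_cocycle tv_nonzero)
  then show ?thesis
    by (metis sigma_inv_in_B)
qed


text \<open>The product of \<open>\<A>\<close> in coordinates. With \<open>t = t\<^sub>1\<close>, \<open>s = \<sigma>(x,y)\<close>, \<open>w = \<sigma>(y,x)\<close>,
  \<open>P = \<sigma>(x,x)\<close> and \<open>F = \<sigma>(y,y)\<close>, every value of \<open>\<sigma>\<close> is polynomial in these five and \<open>1/t\<close>;
  in particular \<open>\<sigma>(z,z) = (s w - P F) / t\<close>. Stated over any field, associativity is then a
  rational identity in which the \<open>t\<^sub>h\<close> no longer occur.\<close>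

definition twist_mult ::
    "'a::field \<Rightarrow> 'a \<Rightarrow> 'a \<Rightarrow> 'a \<Rightarrow> 'a \<Rightarrow> (h4 \<Rightarrow> 'a) \<Rightarrow> (h4 \<Rightarrow> 'a) \<Rightarrow> h4 \<Rightarrow> 'a" where
  "twist_mult t s w P F u v = case_h4
    (t * u H1 * v H1 + P * u HX * v HX + s * u HX * v HY + w * u HY * v HX + F * u HY * v HY
      + (s * w - P * F) / t * u HZ * v HZ)
    (t * (u H1 * v HX + u HX * v H1) - s * u HX * v HZ - F * u HY * v HZ + w * u HZ * v HX
      + F * u HZ * v HY)
    (t * (u H1 * v HY + u HY * v H1) + P * u HX * v HZ + w * u HY * v HZ - P * u HZ * v HX
      - s * u HZ * v HY)
    (t * (u H1 * v HZ + u HZ * v H1) + t * (u HX * v HY - u HY * v HX) + (w - s) * u HZ * v HZ)"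

lemma twist_mult_assoc:
  assumes "t \<noteq> 0"
  shows "twist_mult t s w P F (twist_mult t s w P F f g) h
    = twist_mult t s w P F f (twist_mult t s w P F g h)"
  using assms by (simp add: fun_eq_iff h4_all twist_mult_def field_simps)

lemma A_alg_mult:
  fixes a b c :: "'k::field" and u v :: "h4 \<Rightarrow> 'k KH"
  defines "\<sigma> \<equiv> sigma_bas (cocycle a b c)"
  shows "u \<otimes>\<^bsub>A_alg (cocycle a b c)\<^esub> v
    = twist_mult (tv H1) (\<sigma> HX HY) (\<sigma> HY HX) (X2 a / tv H1) (Y2 a b c / tv H1) u v"
proof
  fix m
  let ?s = "sigma_bas (cocycle a b c)"
  have "(u \<otimes>\<^bsub>A_alg (cocycle a b c)\<^esub> v) m = (\<Sum>g\<in>UNIV. \<Sum>h\<in>UNIV. u g * v h *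
       (\<Sum>g1\<in>UNIV. \<Sum>g2\<in>UNIV. comul g g1 g2 *
          (\<Sum>h1\<in>UNIV. \<Sum>h2\<in>UNIV. comul h h1 h2 * (?s g1 h1 * hmul g2 h2 m))))"
    by (simp only: A_alg_def monoid.simps sum_distrib_left mult.assoc)
  also have "\<dots> = twist_mult (tv H1) (?s HX HY) (?s HY HX) (X2 a / tv H1) (Y2 a b c / tv H1) u v m"
    unfolding comul_sum twist_mult_def
    by (cases m) (simp_all add: UNIV_h4 bas_def sigma_values(1-8,10,12-16) algebra_simps)
  finally show "(u \<otimes>\<^bsub>A_alg (cocycle a b c)\<^esub> v) m
    = twist_mult (tv H1) (\<sigma> HX HY) (\<sigma> HY HX) (X2 a / tv H1) (Y2 a b c / tv H1) u v m"
    unfolding \<sigma>_def .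
qed

lemma twist_mult_one:
  assumes "t \<noteq> 0"
  shows "twist_mult t s w P F (\<lambda>m. inverse t * bas H1 m) u = u"
    and "twist_mult t s w P F u (\<lambda>m. inverse t * bas H1 m) = u"
  using assms by (simp_all add: fun_eq_iff h4_all twist_mult_def bas_def)

lemma twist_mult_bilinear:
  "twist_mult t s w P F (\<lambda>m. u m + v m) z = (\<lambda>m. twist_mult t s w P F u z m + twist_mult t s w P F v z m)"
  "twist_mult t s w P F z (\<lambda>m. u m + v m) = (\<lambda>m. twist_mult t s w P F z u m + twist_mult t s w P F z v m)"
  "twist_mult t s w P F (\<lambda>m. r * u m) z = (\<lambda>m. r * twist_mult t s w P F u z m)"
  "twist_mult t s w P F z (\<lambda>m. r * u m) = (\<lambda>m. r * twist_mult t s w P F z u m)"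
  unfolding fun_eq_iff h4_all by (simp_all add: twist_mult_def algebra_simps add_divide_distrib diff_divide_distrib)

lemma twist_mult_in:
  fixes B :: "'a::field set"
  assumes "scalar_ring B" and "t \<in> B" "s \<in> B" "w \<in> B" "P \<in> B" "F \<in> B" "(s * w - P * F) / t \<in> B"
    and "range u \<subseteq> B" "range v \<subseteq> B"
  shows "twist_mult t s w P F u v m \<in> B"
proof -
  interpret scalar_ring B by fact
  have "u h \<in> B" "v h \<in> B" for h using assms(8,9) by auto
  then show ?thesis
    using assms(2-7)
    by (cases m; simp only: twist_mult_def h4.case; intro add_in diff_in mult_in)
qed

lemma structure_constants_in_B:
  fixes a b c :: "'k::field"
  defines "s \<equiv> sigma_bas (cocycle a b c)" and "B \<equiv> B_set (cocycle a b c)"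
  shows "tv H1 \<in> B" "s HX HY \<in> B" "s HY HX \<in> B" "X2 a / tv H1 \<in> B" "Y2 a b c / tv H1 \<in> B"
    "(s HX HY * s HY HX - X2 a / tv H1 * (Y2 a b c / tv H1)) / tv H1 \<in> B"
  using sigma_in_B[of "cocycle a b c" H1 H1] sigma_in_B[of "cocycle a b c" HX HY]
    sigma_in_B[of "cocycle a b c" HY HX] sigma_in_B[of "cocycle a b c" HX HX]
    sigma_in_B[of "cocycle a b c" HY HY] sigma_in_B[of "cocycle a b c" HZ HZ]
  unfolding s_def B_def by (simp_all only: sigma_values(1,8,12,16))

lemma A_alg_simps:
  "carrier (A_alg \<alpha>) = {u. range u \<subseteq> B_set \<alpha>}"
  "one (A_alg \<alpha>) = (\<lambda>m. inverse (tv H1) * bas H1 m)"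
  "zero (A_alg \<alpha>) = (\<lambda>m. 0)"
  "add (A_alg \<alpha>) = (\<lambda>u v m. u m + v m)"
  "smult (A_alg \<alpha>) = (\<lambda>r u m. r * u m)"
  by (simp_all add: A_alg_def)

lemma assoc_algebra_A_alg:
  fixes a b c :: "'k::field"
  assumes "a \<noteq> 0"
  shows "assoc_algebra (ring_on (B_set (cocycle a b c))) (A_alg (cocycle a b c))"
proof -
  let ?B = "B_set (cocycle a b c)" and ?A = "A_alg (cocycle a b c)"
  interpret scalar_ring ?B by (rule scalar_ring_B_set)
  note inv = inverse_tv_in_B[OF assms, of b c]
  have g: "abelian_group ?A"
  proof (rule abelian_groupI)
    fix u assume "u \<in> carrier ?A"
    then show "\<exists>v\<in>carrier ?A. v \<oplus>\<^bsub>?A\<^esub> u = \<zero>\<^bsub>?A\<^esub>"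
      by (intro bexI[of _ "\<lambda>m. - u m"]) (auto simp: A_alg_simps)
  qed (auto simp: A_alg_simps add.assoc add.commute add.left_commute)
  have m: "Group.monoid ?A"
  proof (rule monoidI)
    show "u \<otimes>\<^bsub>?A\<^esub> v \<in> carrier ?A" if "u \<in> carrier ?A" "v \<in> carrier ?A" for u v
      using that twist_mult_in[OF scalar_ring_B_set structure_constants_in_B]
      by (auto simp: A_alg_simps A_alg_mult)
    show "\<one>\<^bsub>?A\<^esub> \<in> carrier ?A"
      using inv by (auto simp: A_alg_simps bas_def inverse_eq_divide)
  qed (simp_all add: A_alg_mult A_alg_simps(2) twist_mult_assoc twist_mult_one tv_nonzero)
  have r: "ring ?A"
    by (rule ringI[OF g m]) (simp_all add: A_alg_mult A_alg_simps(4) twist_mult_bilinear)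
  have mo: "Module.module (ring_on ?B) ?A"
    by (rule moduleI[OF cring_ring_on g]) (auto simp: A_alg_simps algebra_simps)
  show ?thesis
    by (intro assoc_algebra.intro mo r assoc_algebra_axioms.intro)
      (simp_all add: A_alg_mult A_alg_simps(5) twist_mult_bilinear)
qed

theorem theorem10p7:
  fixes a b c :: "'k::field"
  assumes "infinite (UNIV :: 'k set)"
    and "CHAR('k) \<noteq> 2"
    and "a \<noteq> 0"
  shows "X2 a \<in> B_set (cocycle a b c) \<and> Y2 a b c \<in> B_set (cocycle a b c) \<and>
    TT a b \<in> B_set (cocycle a b c) \<and>
    algebra_isomorphic (ring_on (B_set (cocycle a b c)))
      (A_alg (cocycle a b c))
      (two_gen_algebra (B_set (cocycle a b c)) (X2 a) (Y2 a b c) (TT a b))"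
proof -
  let ?B = "B_set (cocycle a b c)" and ?A = "A_alg (cocycle a b c)"
  let ?\<sigma> = "sigma_bas (cocycle a b c)"
  let ?t = "tv H1 :: 'k KH"
  interpret scalar_ring ?B by (rule scalar_ring_B_set)
  note B = structure_constants_in_B[of a b c] and t = tv_nonzero[of H1, where 'k = 'k]
  note inv = inverse_tv_in_B[OF assms(3), of b c]
  have TT: "TT a b = ?t * (?\<sigma> HX HY + ?\<sigma> HY HX)"
    using t by (simp add: TT_def sigma_values(9,11) field_simps)
  have "?t * (X2 a / ?t) \<in> ?B" "?t * (Y2 a b c / ?t) \<in> ?B" "TT a b \<in> ?B"
    unfolding TT using B by (blast intro: mult_in add_in)+
  then have rel: "X2 a \<in> ?B" "Y2 a b c \<in> ?B" "TT a b \<in> ?B"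
    using t by simp_all
  have bas: "bas h \<in> carrier ?A" for h
    by (auto simp: A_alg_simps bas_def)
  have comb: "lin_comb ?A (bas HX) (bas HY) c0 c1 c2 c3
    = case_h4 (c0 / ?t + c3 * ?\<sigma> HX HY) c1 c2 (c3 * ?t)" for c0 c1 c2 c3
    by (simp add: lin_comb_def A_alg_simps A_alg_mult twist_mult_def bas_def fun_eq_iff h4_all
        field_simps)
  have "clifford_pair (ring_on ?B) ?A (bas HX) (bas HY) (X2 a) (Y2 a b c) (TT a b)"
  proof (intro clifford_pair.intro assoc_algebra_A_alg assms(3) clifford_pair_axioms.intro bas)
    show "bas HX \<otimes>\<^bsub>?A\<^esub> bas HX = X2 a \<odot>\<^bsub>?A\<^esub> \<one>\<^bsub>?A\<^esub>" "bas HY \<otimes>\<^bsub>?A\<^esub> bas HY = Y2 a b c \<odot>\<^bsub>?A\<^esub> \<one>\<^bsub>?A\<^esub>"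
      "bas HX \<otimes>\<^bsub>?A\<^esub> bas HY \<oplus>\<^bsub>?A\<^esub> bas HY \<otimes>\<^bsub>?A\<^esub> bas HX = TT a b \<odot>\<^bsub>?A\<^esub> \<one>\<^bsub>?A\<^esub>"
      using t by (simp_all add: A_alg_simps A_alg_mult twist_mult_def bas_def fun_eq_iff h4_all TT
          field_simps)
  qed (use rel in simp_all)
  moreover have "\<exists>c0\<in>?B. \<exists>c1\<in>?B. \<exists>c2\<in>?B. \<exists>c3\<in>?B. u = lin_comb ?A (bas HX) (bas HY) c0 c1 c2 c3"
    if "u \<in> carrier ?A" for u
  proof -
    have u: "u h \<in> ?B" for h
      using that by (auto simp: A_alg_simps)
    have u3: "u HZ * (1 / ?t) \<in> ?B"
      using u inv by (rule mult_in)
    have "u = lin_comb ?A (bas HX) (bas HY)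
      (?t * (u H1 - u HZ * (1 / ?t) * ?\<sigma> HX HY)) (u HX) (u HY) (u HZ * (1 / ?t))"
      using t by (simp add: comb fun_eq_iff h4_all)
    moreover have "?t * (u H1 - u HZ * (1 / ?t) * ?\<sigma> HX HY) \<in> ?B"
      using u u3 B(1,2) by (blast intro: mult_in diff_in)
    ultimately show ?thesis
      using u u3 by blast
  qed
  moreover have "c0 = 0 \<and> c1 = 0 \<and> c2 = 0 \<and> c3 = 0"
    if "lin_comb ?A (bas HX) (bas HY) c0 c1 c2 c3 = \<zero>\<^bsub>?A\<^esub>" for c0 c1 c2 c3
    using that t by (auto simp: comb A_alg_simps fun_eq_iff h4_all)
  ultimately have "algebra_isomorphic (ring_on ?B) ?A (two_gen_algebra ?B (X2 a) (Y2 a b c) (TT a b))"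
    by (intro algebra_isomorphic_two_gen_algebra[OF scalar_ring_B_set]) blast+
  with rel show ?thesis by blast
qed

end
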